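(* Let $d\in\mathbb{N}$ and let $m,n\ge d+1$ be integers with $m+n\ge\binom{d+2}{2}+1$. Then the complete bipartite graph $K_{m,n}$ is generically globally rigid in dimension $d$.
   Context: A framework $(G,p)$ in dimension $d$ is a graph $G$ together with a configuration $p$, i.e. a map from the vertex set of $G$ to the $d$-dimensional Euclidean space $\mathbb{E}^d$. Two frameworks $(G,p)$ and $(G,q)$ in dimension $d$ are equivalent if $\|p(j)-p(i)\|=\|q(j)-q(i)\|$ for all edges $\{i,j\}$ of $G$; they are congruent if there is a Euclidean motion (isometry) $T$ of $\mathbb{E}^d$ with $q(i)=T(p(i))$ for all vertices $i$ of $G$. A framework $(G,p)$ in dimension $d$ is globally rigid if every framework $(G,q)$ in dimension $d$ equivalent to $(G,p)$ is congruent to it. A configuration is generic if its coordinates are algebraically independent over $\mathbb{Q}$. A graph $G$ is generically globally rigid in dimension $d$ if every generic framework $(G,p)$ in dimension $d$ is globally rigid. $K_{m,n}$ denotes the complete bipartite graph with parts of sizes $m$ and $n$. *)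

theory Defs
  imports
    "HOL-Analysis.Abstract_Euclidean_Space"
    "HOL-Analysis.L2_Norm"
    "HOL-Library.Poly_Mapping"
    "Graph_Theory.Kuratowski"
begin

text \<open>
  The points of \<open>E\<^sup>d\<close> are those of \<^const>\<open>Euclidean_space\<close>: real sequences vanishing
  from index \<open>d\<close> on. Their coordinates are the entries with index below \<open>d\<close>. This keeps
  \<open>d\<close> an arbitrary natural number, \<open>d = 0\<close> included.
\<close>

abbreviation euclid :: "nat \<Rightarrow> (nat \<Rightarrow> real) set" where
  "euclid d \<equiv> topspace (Euclidean_space d)"

definition edist :: "nat \<Rightarrow> (nat \<Rightarrow> real) \<Rightarrow> (nat \<Rightarrow> real) \<Rightarrow> real" where
  "edist d x y = L2_set (\<lambda>k. x k - y k) {..<d}"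

text \<open>Distance-preserving self-maps of \<open>E\<^sup>d\<close> are automatically bijective.\<close>

definition euclid_isometry :: "nat \<Rightarrow> ((nat \<Rightarrow> real) \<Rightarrow> (nat \<Rightarrow> real)) \<Rightarrow> bool" where
  "euclid_isometry d T \<longleftrightarrow> T \<in> euclid d \<rightarrow> euclid d \<and>
     (\<forall>x\<in>euclid d. \<forall>y\<in>euclid d. edist d (T x) (T y) = edist d x y)"

text \<open>
  Graphs are the symmetric digraphs of \<^theory>\<open>Graph_Theory.Digraph\<close>: an edge \<open>{i, j}\<close> is
  the pair of elements \<open>(i, j)\<close> and \<open>(j, i)\<close> of \<^term>\<open>arcs_ends G\<close>. Values of a
  configuration outside \<^term>\<open>verts G\<close> are irrelevant.
\<close>

definition framework :: "nat \<Rightarrow> ('a, 'b) pre_digraph \<Rightarrow> ('a \<Rightarrow> nat \<Rightarrow> real) \<Rightarrow> bool" where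
  "framework d G p \<longleftrightarrow> p \<in> verts G \<rightarrow> euclid d"

definition equivalent ::
    "nat \<Rightarrow> ('a, 'b) pre_digraph \<Rightarrow> ('a \<Rightarrow> nat \<Rightarrow> real) \<Rightarrow> ('a \<Rightarrow> nat \<Rightarrow> real) \<Rightarrow> bool" where
  "equivalent d G p q \<longleftrightarrow>
     (\<forall>(i, j)\<in>arcs_ends G. edist d (p j) (p i) = edist d (q j) (q i))"

definition congruent_frameworks ::
    "nat \<Rightarrow> ('a, 'b) pre_digraph \<Rightarrow> ('a \<Rightarrow> nat \<Rightarrow> real) \<Rightarrow> ('a \<Rightarrow> nat \<Rightarrow> real) \<Rightarrow> bool" where
  "congruent_frameworks d G p q \<longleftrightarrow>
     (\<exists>T. euclid_isometry d T \<and> (\<forall>i\<in>verts G. q i = T (p i)))"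

definition globally_rigid :: "nat \<Rightarrow> ('a, 'b) pre_digraph \<Rightarrow> ('a \<Rightarrow> nat \<Rightarrow> real) \<Rightarrow> bool" where
  "globally_rigid d G p \<longleftrightarrow>
     (\<forall>q. framework d G q \<longrightarrow> equivalent d G p q \<longrightarrow> congruent_frameworks d G p q)"

text \<open>
  A polynomial over \<open>\<rat>\<close> with indeterminates indexed by \<open>'i\<close> is a finitely supported map from
  monomials to coefficients, a monomial being a finitely supported map from indeterminates
  to exponents.
\<close>

type_synonym 'i rat_mpoly = "('i \<Rightarrow>\<^sub>0 nat) \<Rightarrow>\<^sub>0 rat"

definition mpoly_eval :: "'i rat_mpoly \<Rightarrow> ('i \<Rightarrow> real) \<Rightarrow> real" where
  "mpoly_eval P x =
     (\<Sum>m\<in>Poly_Mapping.keys P. of_rat (Poly_Mapping.lookup P m) *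
        (\<Prod>i\<in>Poly_Mapping.keys m. x i ^ Poly_Mapping.lookup m i))"

text \<open>Algebraic independence of the family \<open>(x i)\<close>, \<open>i \<in> I\<close>; in particular \<open>x\<close> is injective on \<open>I\<close>.\<close>

definition algebraically_independent :: "('i \<Rightarrow> real) \<Rightarrow> 'i set \<Rightarrow> bool" where
  "algebraically_independent x I \<longleftrightarrow>
     (\<forall>P :: 'i rat_mpoly. (\<forall>m\<in>Poly_Mapping.keys P. Poly_Mapping.keys m \<subseteq> I) \<longrightarrow>
        mpoly_eval P x = 0 \<longrightarrow> P = 0)"

definition generic :: "nat \<Rightarrow> ('a, 'b) pre_digraph \<Rightarrow> ('a \<Rightarrow> nat \<Rightarrow> real) \<Rightarrow> bool" where
  "generic d G p \<longleftrightarrow> algebraically_independent (\<lambda>(v, k). p v k) (verts G \<times> {..<d})"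

definition generically_globally_rigid :: "nat \<Rightarrow> ('a, 'b) pre_digraph \<Rightarrow> bool" where
  "generically_globally_rigid d G \<longleftrightarrow>
     (\<forall>p. framework d G p \<longrightarrow> generic d G p \<longrightarrow> globally_rigid d G p)"

end

theory Submission
  imports Defs "Jordan_Normal_Form.Determinant"
begin

text \<open>
  The proof is a dimension count. Let \<open>a\<^sub>i\<close> and \<open>b\<^sub>j\<close> be the points of the two parts of a generic
  framework and \<open>a'\<^sub>i\<close>, \<open>b'\<^sub>j\<close> those of an equivalent one. Because all distances between the two
  parts agree, so do the inner products \<open>(a\<^sub>i - a\<^sub>0) \<bullet> (b\<^sub>j - b\<^sub>0)\<close> of differences taken within each
  part. Each part contains an affinely independent set of \<open>d + 1\<close> points, so this alone makes the
  new points affine images of the old ones: \<open>a'\<^sub>i = B a\<^sub>i + s\<close> and \<open>b'\<^sub>j = C b\<^sub>j + t\<close> with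
  \<open>B\<^sup>T C = 1\<close> (\<open>bipartite_distances_affine\<close>). The maps on the two parts need not agree a priori.

  With \<open>S = B\<^sup>T B\<close> and \<open>y = C\<^sup>T (s - t)\<close>, what is left of the distance equations says that, for some
  constant \<open>\<kappa>\<close>, all \<open>a\<^sub>i\<close> lie on the quadric \<open>(a + y) \<bullet> S (a + y) - a \<bullet> a = \<kappa>\<close> and all \<open>b\<^sub>j\<close> on the
  quadric \<open>b \<bullet> b - b \<bullet> S' b + 2 y \<bullet> b = \<kappa>\<close>, where \<open>S'\<close> is the inverse of \<open>S\<close>. The triple \<open>(S, y, \<kappa>)\<close>
  has at most \<open>(d + 2) choose 2\<close> different entries, as \<open>S\<close> is symmetric. Unless \<open>(S, y, \<kappa>) = (1, 0, 0)\<close>,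
  both equations are nontrivial, so every one of the points loses a degree of freedom over the field
  generated by the triple, and the coordinates of all
  points together have transcendence degree at most \<open>(m + n) (d - 1) + ((d + 2) choose 2)\<close>. This is
  less than \<open>(m + n) d\<close>, which contradicts genericity (\<open>generic_quadric_system_trivial\<close>). Hence
  \<open>S = 1\<close> and \<open>y = 0\<close>, which means that \<open>B = C\<close> is orthogonal and \<open>s = t\<close>: one isometry carries the
  whole framework to the other.

  The count rests on the bound of the transcendence degree by the number of generators
  (\<open>card_le_of_algebraic\<close>), which is proved by comparing the growth of spaces of monomials.
\<close>

no_notation Inner_Product.real_inner_class.inner (infix "\<bullet>" 70)

section \<open>Algebraic independence as linear independence of monomials\<close>

interpretation rat_real: vector_space "\<lambda>(q::rat) (r::real). of_rat q * r"
  by unfold_locales (simp_all add: algebra_simps of_rat_add of_rat_mult)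

text \<open>
  The family need not be injective: two equal members are a dependence by themselves, so the
  number of indices is what counts, not the number of values.
\<close>

lemma rat_dependent_family:
  fixes f :: "'i \<Rightarrow> real"
  assumes "finite A" "finite B" "f ` A \<subseteq> rat_real.span B" "card B < card A"
  shows "\<exists>c. (\<exists>a\<in>A. c a \<noteq> 0) \<and> (\<Sum>a\<in>A. of_rat (c a) * f a) = 0"
proof (cases "inj_on f A")
  case True
  have "rat_real.dependent (f ` A)"
  proof (rule ccontr)
    assume "\<not> ?thesis"
    then have "card (f ` A) \<le> card B"
      using rat_real.independent_span_bound assms by blast
    then show False
      using assms(4) card_image[OF True] by simp
  qed
  then obtain u where u: "\<exists>v\<in>f ` A. u v \<noteq> 0" "(\<Sum>v\<in>f ` A. of_rat (u v) * v) = 0"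
    using rat_real.dependent_finite[of "f ` A"] assms(1) by auto
  show ?thesis
    using u True by (intro exI[of _ "u \<circ> f"]) (auto simp: sum.reindex)
next
  case False
  then obtain a b where ab: "a \<in> A" "b \<in> A" "a \<noteq> b" "f a = f b"
    by (auto simp: inj_on_def)
  let ?c = "\<lambda>x. if x = a then 1 else if x = b then - 1 else (0::rat)"
  have "(\<Sum>x\<in>A. of_rat (?c x) * f x) = (\<Sum>x\<in>{a, b}. of_rat (?c x) * f x)"
    using ab assms(1) by (intro sum.mono_neutral_right) auto
  also have "\<dots> = 0"
    using ab by simp
  finally show ?thesis
    using ab by (intro exI[of _ ?c]) auto
qed

text \<open>
  Algebraic independence in the form in which the counting argument contradicts it: exponents are
  plain functions in a box, and the polynomial is assembled from its coefficients here once.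
\<close>

lemma algebraically_independent_monomials:
  fixes x :: "'i \<Rightarrow> real" and c :: "('i \<Rightarrow> nat) \<Rightarrow> rat"
  assumes ind: "algebraically_independent x I" and fin: "finite I"
    and sum0: "(\<Sum>t\<in>I \<rightarrow>\<^sub>E {..T}. of_rat (c t) * (\<Prod>i\<in>I. x i ^ t i)) = 0"
    and t: "t \<in> I \<rightarrow>\<^sub>E {..T}"
  shows "c t = 0"
proof -
  let ?M = "I \<rightarrow>\<^sub>E {..T}"
  define mon :: "('i \<Rightarrow> nat) \<Rightarrow> ('i \<Rightarrow>\<^sub>0 nat)"
    where "mon t = Abs_poly_mapping (\<lambda>i. if i \<in> I then t i else 0)" for t
  have lookup_mon: "Poly_Mapping.lookup (mon t) = (\<lambda>i. if i \<in> I then t i else 0)" for t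
    unfolding mon_def
    by (rule lookup_Abs_poly_mapping) (rule finite_subset[OF _ fin], rule subsetI, rule ccontr, simp)
  have keys_mon: "Poly_Mapping.keys (mon t) \<subseteq> I" for t
    by (rule subsetI, rule ccontr) (simp add: in_keys_iff lookup_mon)
  have finM: "finite ?M"
    using fin by (intro finite_PiE) auto
  have inj: "inj_on mon ?M"
  proof (rule inj_onI)
    fix s t assume st: "s \<in> ?M" "t \<in> ?M" "mon s = mon t"
    show "s = t"
    proof (rule PiE_ext[OF st(1,2)])
      fix i assume "i \<in> I"
      then show "s i = t i"
        using fun_cong[OF arg_cong[OF st(3), of Poly_Mapping.lookup], of i]
        by (simp add: lookup_mon)
    qed
  qed
  define P where "P = (\<Sum>t\<in>?M. Poly_Mapping.single (mon t) (c t))"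
  have lookup_P: "Poly_Mapping.lookup P (mon t) = c t" if "t \<in> ?M" for t
  proof -
    have "Poly_Mapping.lookup P (mon t) = (\<Sum>s\<in>?M. if s = t then c s else 0)"
      unfolding P_def lookup_sum lookup_single when_def
      using inj that by (intro sum.cong) (auto simp: inj_on_def)
    then show ?thesis
      using that finM by simp
  qed
  have keys_P: "Poly_Mapping.keys P \<subseteq> mon ` ?M"
  proof -
    have "Poly_Mapping.keys P \<subseteq> (\<Union>t\<in>?M. Poly_Mapping.keys (Poly_Mapping.single (mon t) (c t)))"
      unfolding P_def by (rule keys_sum)
    also have "\<dots> \<subseteq> mon ` ?M"
      by (auto split: if_splits)
    finally show ?thesis .
  qed
  have eval_mon: "(\<Prod>i\<in>Poly_Mapping.keys (mon t). x i ^ Poly_Mapping.lookup (mon t) i) = (\<Prod>i\<in>I. x i ^ t i)" for t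
  proof -
    have "(\<Prod>i\<in>Poly_Mapping.keys (mon t). x i ^ Poly_Mapping.lookup (mon t) i)
        = (\<Prod>i\<in>I. x i ^ Poly_Mapping.lookup (mon t) i)"
      using fin keys_mon[of t]
      by (intro prod.mono_neutral_left) (auto simp: in_keys_iff)
    then show ?thesis
      by (simp add: lookup_mon)
  qed
  have "mpoly_eval P x = (\<Sum>m\<in>mon ` ?M. of_rat (Poly_Mapping.lookup P m) *
        (\<Prod>i\<in>Poly_Mapping.keys m. x i ^ Poly_Mapping.lookup m i))"
    unfolding mpoly_eval_def using finM keys_P
    by (intro sum.mono_neutral_left) (auto simp: in_keys_iff)
  also have "\<dots> = (\<Sum>t\<in>?M. of_rat (c t) * (\<Prod>i\<in>I. x i ^ t i))"
    by (subst sum.reindex[OF inj]) (simp add: lookup_P eval_mon)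
  finally have "mpoly_eval P x = 0"
    using sum0 by simp
  moreover have "\<forall>m\<in>Poly_Mapping.keys P. Poly_Mapping.keys m \<subseteq> I"
    using keys_P keys_mon by blast
  ultimately have "P = 0"
    using ind unfolding algebraically_independent_def by blast
  then show ?thesis
    using lookup_P[OF t] by simp
qed

lemma algebraically_independent_subset:
  "algebraically_independent x I \<Longrightarrow> J \<subseteq> I \<Longrightarrow> algebraically_independent x J"
  unfolding algebraically_independent_def by blast

section \<open>Algebraic elements over a finitely generated subring\<close>

text \<open>
  The subring \<open>\<rat>[Y]\<close> of the reals. Working over this ring instead of the field \<open>\<rat>(Y)\<close> costs nothing,
  since denominators can be cleared in algebraic relations, and it keeps membership proofs free of
  case distinctions on division by zero.
\<close>

inductive_set rat_adjoin :: "real set \<Rightarrow> real set" for Y where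
  rat_adjoin_rat: "of_rat q \<in> rat_adjoin Y"
| rat_adjoin_gen: "y \<in> Y \<Longrightarrow> y \<in> rat_adjoin Y"
| rat_adjoin_add: "a \<in> rat_adjoin Y \<Longrightarrow> b \<in> rat_adjoin Y \<Longrightarrow> a + b \<in> rat_adjoin Y"
| rat_adjoin_mult: "a \<in> rat_adjoin Y \<Longrightarrow> b \<in> rat_adjoin Y \<Longrightarrow> a * b \<in> rat_adjoin Y"

lemma rat_adjoin_0: "0 \<in> rat_adjoin Y" and rat_adjoin_1: "1 \<in> rat_adjoin Y"
  using rat_adjoin_rat[of 0 Y] rat_adjoin_rat[of 1 Y] by simp_all

lemma rat_adjoin_uminus: "a \<in> rat_adjoin Y \<Longrightarrow> - a \<in> rat_adjoin Y"
  using rat_adjoin_mult[OF rat_adjoin_rat[of "-1" Y]] by fastforce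

lemma rat_adjoin_diff: "a \<in> rat_adjoin Y \<Longrightarrow> b \<in> rat_adjoin Y \<Longrightarrow> a - b \<in> rat_adjoin Y"
  using rat_adjoin_add[OF _ rat_adjoin_uminus, of a Y b] by simp

lemma rat_adjoin_sum: "(\<And>i. i \<in> A \<Longrightarrow> f i \<in> rat_adjoin Y) \<Longrightarrow> sum f A \<in> rat_adjoin Y"
  by (induction A rule: infinite_finite_induct) (auto intro: rat_adjoin_0 rat_adjoin_add)

lemma rat_adjoin_prod: "(\<And>i. i \<in> A \<Longrightarrow> f i \<in> rat_adjoin Y) \<Longrightarrow> prod f A \<in> rat_adjoin Y"
  by (induction A rule: infinite_finite_induct) (auto intro: rat_adjoin_1 rat_adjoin_mult)

lemma rat_adjoin_numeral: "numeral k \<in> rat_adjoin Y"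
  using rat_adjoin_rat[of "numeral k" Y] by simp

lemmas rat_adjoin_intros =
  rat_adjoin_gen rat_adjoin_add rat_adjoin_mult rat_adjoin_0 rat_adjoin_1 rat_adjoin_uminus
  rat_adjoin_diff rat_adjoin_sum rat_adjoin_prod rat_adjoin_numeral

lemma rat_adjoin_mono: "Y \<subseteq> Z \<Longrightarrow> rat_adjoin Y \<subseteq> rat_adjoin Z"
proof
  fix r assume "Y \<subseteq> Z" "r \<in> rat_adjoin Y"
  then show "r \<in> rat_adjoin Z"
    by (induction rule: rat_adjoin.induct[OF \<open>r \<in> rat_adjoin Y\<close>]) (auto intro: rat_adjoin.intros)
qed

text \<open>
  The leading coefficient is required to be nonzero as a real number, and not just as an expression in the
  generators, because the counting argument cancels powers of it.
\<close>

definition algebraic_over :: "real set \<Rightarrow> real \<Rightarrow> bool" where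
  "algebraic_over K r \<longleftrightarrow>
     (\<exists>e c. (\<forall>k\<le>e. c k \<in> K) \<and> c e \<noteq> 0 \<and> (\<Sum>k\<le>e. c k * r ^ k) = (0::real))"

text \<open>
  Each exponent is bounded separately, instead of the total degree, so that the monomials
  are counted by a plain power.
\<close>

definition bounded_monomials :: "real set \<Rightarrow> nat \<Rightarrow> real set" where
  "bounded_monomials Y D = (\<lambda>s. \<Prod>y\<in>Y. y ^ s y) ` (Y \<rightarrow>\<^sub>E {..D})"

lemma bounded_monomials_mult:
  assumes "a \<in> bounded_monomials Y D" "b \<in> bounded_monomials Y D'"
  shows "a * b \<in> bounded_monomials Y (D + D')"
proof -
  obtain s t where st: "s \<in> Y \<rightarrow>\<^sub>E {..D}" "t \<in> Y \<rightarrow>\<^sub>E {..D'}"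
    and ab: "a = (\<Prod>y\<in>Y. y ^ s y)" "b = (\<Prod>y\<in>Y. y ^ t y)"
    using assms by (auto simp: bounded_monomials_def)
  have "a * b = (\<Prod>y\<in>Y. y ^ restrict (\<lambda>y. s y + t y) Y y)"
    by (simp add: ab power_add prod.distrib)
  moreover have "restrict (\<lambda>y. s y + t y) Y \<in> Y \<rightarrow>\<^sub>E {..D + D'}"
    using PiE_mem[OF st(1)] PiE_mem[OF st(2)] by (fastforce intro: add_mono)
  ultimately show ?thesis
    unfolding bounded_monomials_def by (rule image_eqI)
qed

lemma bounded_monomials_mono: "D \<le> D' \<Longrightarrow> bounded_monomials Y D \<subseteq> bounded_monomials Y D'"
  unfolding bounded_monomials_def by (intro image_mono PiE_mono) auto

lemma one_in_bounded_monomials: "1 \<in> bounded_monomials Y D"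
  unfolding bounded_monomials_def by (rule image_eqI[of _ _ "restrict (\<lambda>_. 0) Y"]) auto

lemma card_bounded_monomials:
  assumes "finite Y"
  shows "finite (bounded_monomials Y D)" "card (bounded_monomials Y D) \<le> Suc D ^ card Y"
proof -
  have fin: "finite (Y \<rightarrow>\<^sub>E {..D})"
    using assms by (intro finite_PiE) auto
  then show "finite (bounded_monomials Y D)"
    by (simp add: bounded_monomials_def)
  have "card (bounded_monomials Y D) \<le> card (Y \<rightarrow>\<^sub>E {..D})"
    unfolding bounded_monomials_def by (rule card_image_le[OF fin])
  also have "\<dots> = Suc D ^ card Y"
    using assms by (simp add: card_PiE)
  finally show "card (bounded_monomials Y D) \<le> Suc D ^ card Y" .
qed

lemma rat_real_span_mult:
  assumes "a \<in> rat_real.span A" "b \<in> rat_real.span B"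
    and "\<And>a b. a \<in> A \<Longrightarrow> b \<in> B \<Longrightarrow> a * b \<in> rat_real.span C"
  shows "a * b \<in> rat_real.span C"
  using assms(1)
proof (induction rule: rat_real.span_induct_alt)
  case base
  show ?case by (simp add: rat_real.span_zero)
next
  case (step q a' a)
  have "a' * b \<in> rat_real.span C"
    using assms(2)
  proof (induction rule: rat_real.span_induct_alt)
    case base
    show ?case by (simp add: rat_real.span_zero)
  next
    case (step q b' b)
    have "of_rat q * (a' * b') + a' * b \<in> rat_real.span C"
      using assms(3)[OF \<open>a' \<in> A\<close> step(1)] step(2)
      by (intro rat_real.span_add rat_real.span_scale)
    then show ?case by (simp add: algebra_simps)
  qed
  then have "of_rat q * (a' * b) + a * b \<in> rat_real.span C"
    using step by (intro rat_real.span_add rat_real.span_scale)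
  then show ?case by (simp add: algebra_simps)
qed

lemma rat_adjoin_span_bounded_monomials:
  assumes "finite Y" "r \<in> rat_adjoin Y"
  shows "\<exists>D. r \<in> rat_real.span (bounded_monomials Y D)"
  using assms(2)
proof (induction rule: rat_adjoin.induct)
  case (rat_adjoin_rat q)
  have "of_rat q * 1 \<in> rat_real.span (bounded_monomials Y 0)"
    by (intro rat_real.span_scale rat_real.span_base one_in_bounded_monomials)
  then show ?case by auto
next
  case (rat_adjoin_gen y)
  have "y = (\<Prod>z\<in>Y. if z = y then z else 1)"
    using assms(1) rat_adjoin_gen by simp
  also have "\<dots> = (\<Prod>z\<in>Y. z ^ restrict (\<lambda>z. if z = y then 1 else 0) Y z)"
    by (intro prod.cong) auto
  also have "\<dots> \<in> bounded_monomials Y 1"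
    unfolding bounded_monomials_def by (intro imageI) auto
  finally show ?case
    by (blast intro: rat_real.span_base)
next
  case (rat_adjoin_add a b)
  then obtain D D' where "a \<in> rat_real.span (bounded_monomials Y D)"
    "b \<in> rat_real.span (bounded_monomials Y D')" by auto
  then have "a + b \<in> rat_real.span (bounded_monomials Y (max D D'))"
    using rat_real.span_mono[OF bounded_monomials_mono, of D "max D D'" Y]
      rat_real.span_mono[OF bounded_monomials_mono, of D' "max D D'" Y]
    by (intro rat_real.span_add) auto
  then show ?case ..
next
  case (rat_adjoin_mult a b)
  then obtain D D' where "a \<in> rat_real.span (bounded_monomials Y D)"
    "b \<in> rat_real.span (bounded_monomials Y D')" by auto
  then have "a * b \<in> rat_real.span (bounded_monomials Y (D + D'))"
    by (rule rat_real_span_mult) (intro rat_real.span_base bounded_monomials_mult)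
  then show ?case ..
qed

lemma finite_rat_adjoin_span_bounded_monomials:
  assumes "finite Y" "finite F" "F \<subseteq> rat_adjoin Y"
  shows "\<exists>D. F \<subseteq> rat_real.span (bounded_monomials Y D)"
  using assms(2,3)
proof (induction F rule: finite_induct)
  case (insert r F)
  obtain D where D: "F \<subseteq> rat_real.span (bounded_monomials Y D)"
    using insert by auto
  obtain D' where D': "r \<in> rat_real.span (bounded_monomials Y D')"
    using rat_adjoin_span_bounded_monomials[OF assms(1), of r] insert by auto
  show ?case
    using D D' rat_real.span_mono[OF bounded_monomials_mono, of D "max D D'" Y]
      rat_real.span_mono[OF bounded_monomials_mono, of D' "max D D'" Y]
    by (intro exI[of _ "max D D'"]) auto
qed auto

section \<open>Transcendence degree is bounded by the number of generators\<close>

text \<open>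
  A finite family of reals algebraic over \<open>\<rat>[Y]\<close>, with a common bound \<open>D\<close> for the degrees of all
  coefficients in the generators: with one bound for all, the number of reduction steps alone controls
  the growth of exponents.
\<close>

locale algebraic_family =
  fixes I :: "'i set" and Y :: "real set" and x :: "'i \<Rightarrow> real"
    and e :: "'i \<Rightarrow> nat" and c :: "'i \<Rightarrow> nat \<Rightarrow> real" and D :: nat
  assumes finI: "finite I" and finY: "finite Y"
    and coeff: "\<And>i k. i \<in> I \<Longrightarrow> k \<le> e i \<Longrightarrow> c i k \<in> rat_real.span (bounded_monomials Y D)"
    and lead: "\<And>i. i \<in> I \<Longrightarrow> c i (e i) \<noteq> 0"
    and root: "\<And>i. i \<in> I \<Longrightarrow> (\<Sum>k\<le>e i. c i k * x i ^ k) = 0"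
begin

text \<open>
  Normal forms: the exponent of \<open>x i\<close> stays below the degree of its algebraic relation, so only
  the degree in \<open>Y\<close> grows with the parameter.
\<close>

definition reduced :: "nat \<Rightarrow> real set" where
  "reduced D' = (\<lambda>(\<mu>, k). \<mu> * (\<Prod>i\<in>I. x i ^ k i)) `
     (bounded_monomials Y D' \<times> (\<Pi>\<^sub>E i\<in>I. {..<e i}))"

lemma degree_pos: "i \<in> I \<Longrightarrow> e i > 0"
  using root[of i] lead[of i] by (cases "e i") auto

lemma card_reduced:
  "finite (reduced D')" "card (reduced D') \<le> Suc D' ^ card Y * (\<Prod>i\<in>I. e i)"
proof -
  have fin: "finite (bounded_monomials Y D' \<times> (\<Pi>\<^sub>E i\<in>I. {..<e i}))"
    using card_bounded_monomials(1)[OF finY] finI by (auto intro!: finite_PiE)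
  then show "finite (reduced D')"
    by (simp add: reduced_def)
  have "card (reduced D') \<le> card (bounded_monomials Y D' \<times> (\<Pi>\<^sub>E i\<in>I. {..<e i}))"
    unfolding reduced_def by (rule card_image_le[OF fin])
  also have "\<dots> = card (bounded_monomials Y D') * (\<Prod>i\<in>I. e i)"
    using finI by (simp add: card_cartesian_product card_PiE)
  also have "\<dots> \<le> Suc D' ^ card Y * (\<Prod>i\<in>I. e i)"
    by (intro mult_right_mono card_bounded_monomials(2)[OF finY]) simp
  finally show "card (reduced D') \<le> Suc D' ^ card Y * (\<Prod>i\<in>I. e i)" .
qed

lemma span_reduced_mult:
  assumes "a \<in> rat_real.span (bounded_monomials Y D1)" "z \<in> rat_real.span (reduced D2)"
  shows "a * z \<in> rat_real.span (reduced (D1 + D2))"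
  using assms
proof (rule rat_real_span_mult)
  fix a b assume a: "a \<in> bounded_monomials Y D1" and b: "b \<in> reduced D2"
  from b obtain \<mu> k where "b = \<mu> * (\<Prod>i\<in>I. x i ^ k i)" "\<mu> \<in> bounded_monomials Y D2"
    "k \<in> (\<Pi>\<^sub>E i\<in>I. {..<e i})"
    by (auto simp: reduced_def)
  then have "a * b \<in> reduced (D1 + D2)"
    using bounded_monomials_mult[OF a]
    by (auto simp: reduced_def mult.assoc intro!: image_eqI[of _ _ "(a * \<mu>, k)"])
  then show "a * b \<in> rat_real.span (reduced (D1 + D2))"
    by (rule rat_real.span_base)
qed

lemma reduced_replace:
  assumes "\<mu> \<in> bounded_monomials Y D'" "k \<in> (\<Pi>\<^sub>E i\<in>I. {..<e i})" "i \<in> I" "r < e i"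
  shows "x i ^ r * (\<mu> * (\<Prod>j\<in>I - {i}. x j ^ k j)) \<in> reduced D'"
proof -
  have "(\<Prod>j\<in>I. x j ^ (k(i := r)) j) = x i ^ r * (\<Prod>j\<in>I - {i}. x j ^ k j)"
    using assms(3) finI by (subst prod.remove[of I i]) auto
  then have "x i ^ r * (\<mu> * (\<Prod>j\<in>I - {i}. x j ^ k j)) = \<mu> * (\<Prod>j\<in>I. x j ^ (k(i := r)) j)"
    by simp
  moreover have "k(i := r) \<in> (\<Pi>\<^sub>E i\<in>I. {..<e i})"
    using assms by (auto simp: PiE_iff extensional_def)
  ultimately show ?thesis
    using assms(1) unfolding reduced_def by (intro image_eqI[of _ _ "(\<mu>, k(i := r))"]) auto
qed

text \<open>
  Multiplication by \<open>x i\<close> may push its exponent to \<open>e i\<close>. The leading coefficient as an extra factor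
  makes it possible to reduce that power by the algebraic relation without dividing.
\<close>

lemma span_reduced_lead_mult:
  assumes i: "i \<in> I" and z: "z \<in> rat_real.span (reduced D')"
  shows "c i (e i) * x i * z \<in> rat_real.span (reduced (D + D'))"
proof (rule rat_real_span_mult[OF _ z])
  show "c i (e i) * x i \<in> rat_real.span {c i (e i) * x i}"
    by (rule rat_real.span_base) simp
next
  fix a b assume a: "a \<in> {c i (e i) * x i}" and "b \<in> reduced D'"
  then obtain \<mu> k where b: "b = \<mu> * (\<Prod>i\<in>I. x i ^ k i)" and \<mu>: "\<mu> \<in> bounded_monomials Y D'"
    and k: "k \<in> (\<Pi>\<^sub>E i\<in>I. {..<e i})"
    by (auto simp: reduced_def)
  define rest where "rest = \<mu> * (\<Prod>j\<in>I - {i}. x j ^ k j)"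
  have b_rest: "b = x i ^ k i * rest"
    using i finI unfolding b rest_def by (subst prod.remove[of I i]) auto
  have red: "x i ^ r * rest \<in> rat_real.span (reduced D')" if "r < e i" for r
    using reduced_replace[OF \<mu> k i that] unfolding rest_def by (rule rat_real.span_base)
  have "k i < e i"
    using k i by auto
  show "a * b \<in> rat_real.span (reduced (D + D'))"
  proof (cases "Suc (k i) < e i")
    case True
    have "c i (e i) * (x i ^ Suc (k i) * rest) \<in> rat_real.span (reduced (D + D'))"
      by (intro span_reduced_mult coeff i red True order.refl)
    then show ?thesis
      using a by (simp add: b_rest algebra_simps)
  next
    case False
    with \<open>k i < e i\<close> have e: "e i = Suc (k i)" by simp
    have "c i (e i) * x i ^ e i = - (\<Sum>r<e i. c i r * x i ^ r)"
      using root[OF i] by (simp add: lessThan_Suc_atMost[symmetric])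
    moreover have "a * b = c i (e i) * x i ^ e i * rest"
      using a by (simp add: b_rest e mult_ac)
    ultimately have "a * b = - (\<Sum>r<e i. c i r * x i ^ r) * rest"
      by simp
    also have "\<dots> = - (\<Sum>r<e i. c i r * (x i ^ r * rest))"
      by (simp add: sum_distrib_right mult.assoc)
    also have "\<dots> \<in> rat_real.span (reduced (D + D'))"
      by (intro rat_real.span_neg rat_real.span_sum span_reduced_mult coeff i red) auto
    finally show ?thesis .
  qed
qed

lemma span_reduced_power_mult:
  assumes i: "i \<in> I" and z: "z \<in> rat_real.span (reduced D')" and "m \<le> n"
  shows "c i (e i) ^ n * x i ^ m * z \<in> rat_real.span (reduced (n * D + D'))"
  using \<open>m \<le> n\<close>
proof (induction n arbitrary: m)
  case 0
  then show ?case using z by simp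
next
  case (Suc n)
  show ?case
  proof (cases m)
    case 0
    have "c i (e i) * (c i (e i) ^ n * x i ^ 0 * z) \<in> rat_real.span (reduced (D + (n * D + D')))"
      by (intro span_reduced_mult coeff i Suc) auto
    then show ?thesis by (simp add: 0 algebra_simps)
  next
    case (Suc m')
    have "c i (e i) * x i * (c i (e i) ^ n * x i ^ m' * z) \<in> rat_real.span (reduced (D + (n * D + D')))"
      using Suc Suc.prems by (intro span_reduced_lead_mult i Suc.IH) auto
    then show ?thesis by (simp add: Suc algebra_simps)
  qed
qed

text \<open>
  The factor in front of the monomial does not depend on \<open>t\<close>: this is why each \<open>x i\<close> gets the full
  power \<open>T\<close> of its leading coefficient, even if fewer are needed to reduce it. A linear relation
  between the scaled monomials is therefore one between the monomials.
\<close>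

lemma scaled_monomial_in_span_reduced:
  assumes "\<And>i. i \<in> I \<Longrightarrow> t i \<le> T"
  shows "(\<Prod>i\<in>I. c i (e i) ^ T * x i ^ t i) \<in> rat_real.span (reduced (card I * T * D))"
proof -
  have "(\<Prod>i\<in>J. c i (e i) ^ T * x i ^ t i) \<in> rat_real.span (reduced (card J * T * D))"
    if "J \<subseteq> I" for J
    using finite_subset[OF that finI] that
  proof (induction J rule: finite_induct)
    case empty
    have "1 = 1 * (\<Prod>i\<in>I. x i ^ restrict (\<lambda>_. 0) I i)"
      by simp
    also have "\<dots> \<in> reduced 0"
      unfolding reduced_def
      by (intro image_eqI[of _ _ "(1, restrict (\<lambda>_. 0) I)"])
         (auto simp: one_in_bounded_monomials degree_pos)
    finally show ?case
      by (simp add: rat_real.span_base)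
  next
    case (insert i J)
    then have "c i (e i) ^ T * x i ^ t i * (\<Prod>i\<in>J. c i (e i) ^ T * x i ^ t i)
        \<in> rat_real.span (reduced (T * D + card J * T * D))"
      using assms by (intro span_reduced_power_mult) auto
    then show ?case
      using insert by (simp add: algebra_simps)
  qed
  then show ?thesis by blast
qed

end

text \<open>
  There are \<open>(T + 1) ^ card I\<close> monomials in \<open>x\<close> with exponents at most \<open>T\<close>. Up to a common factor they
  all lie in a rational vector space whose dimension grows like \<open>T ^ card Y\<close>. If \<open>card Y < card I\<close>, they
  are linearly dependent for large \<open>T\<close>, against algebraic independence.
\<close>

theorem card_le_of_algebraic:
  fixes x :: "'i \<Rightarrow> real"
  assumes ind: "algebraically_independent x I" and finI: "finite I" and finY: "finite Y"
    and alg: "\<And>i. i \<in> I \<Longrightarrow> algebraic_over (rat_adjoin Y) (x i)"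
  shows "card I \<le> card Y"
proof (rule ccontr)
  assume "\<not> card I \<le> card Y"
  have "\<exists>p. (\<forall>k\<le>fst p. snd p k \<in> rat_adjoin Y) \<and> snd p (fst p) \<noteq> 0 \<and>
      (\<Sum>k\<le>fst p. snd p k * x i ^ k) = 0" if "i \<in> I" for i
    using alg[OF that] unfolding algebraic_over_def by (simp add: split_paired_Ex)
  then obtain p where p: "\<And>i. i \<in> I \<Longrightarrow> (\<forall>k\<le>fst (p i). snd (p i) k \<in> rat_adjoin Y) \<and>
      snd (p i) (fst (p i)) \<noteq> 0 \<and> (\<Sum>k\<le>fst (p i). snd (p i) k * x i ^ k) = 0"
    by metis
  define e where "e i = fst (p i)" for i
  define c where "c i = snd (p i)" for i
  note p = p[folded e_def c_def]
  let ?F = "(\<lambda>(i, k). c i k) ` (SIGMA i:I. {..e i})"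
  have "finite ?F" "?F \<subseteq> rat_adjoin Y"
    using finI p by auto
  then obtain D where D: "?F \<subseteq> rat_real.span (bounded_monomials Y D)"
    using finite_rat_adjoin_span_bounded_monomials[OF finY] by blast
  interpret algebraic_family I Y x e c D
  proof
    fix i k assume "i \<in> I" "k \<le> e i"
    then show "c i k \<in> rat_real.span (bounded_monomials Y D)"
      using D by auto
  qed (use finI finY p in auto)
  define E where "E = (\<Prod>i\<in>I. e i)"
  \<comment> \<open>Large enough for the number of monomials to exceed the dimension bound in the chain below.\<close>
  define T where "T = Suc (card I * D) ^ card Y * E"
  let ?A = "I \<rightarrow>\<^sub>E {..T}"
  define f where "f t = (\<Prod>i\<in>I. c i (e i) ^ T * x i ^ t i)" for t
  have f_span: "f ` ?A \<subseteq> rat_real.span (reduced (card I * T * D))"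
    unfolding f_def by (auto intro!: scaled_monomial_in_span_reduced)
  have "card (reduced (card I * T * D)) \<le> Suc (card I * T * D) ^ card Y * E"
    using card_reduced(2) unfolding E_def .
  also have "\<dots> \<le> (Suc (card I * D) * Suc T) ^ card Y * E"
    by (intro mult_right_mono power_mono) auto
  also have "\<dots> = (Suc (card I * D) ^ card Y * E) * Suc T ^ card Y"
    by (simp only: power_mult_distrib mult_ac)
  also have "\<dots> = T * Suc T ^ card Y"
    by (simp only: T_def[symmetric])
  also have "\<dots> < Suc T ^ Suc (card Y)"
    by simp
  also have "\<dots> \<le> Suc T ^ card I"
    using \<open>\<not> card I \<le> card Y\<close> by (intro power_increasing) auto
  also have "\<dots> = card ?A"
    using finI by (simp add: card_PiE)
  finally obtain q where q: "\<exists>t\<in>?A. q t \<noteq> 0" "(\<Sum>t\<in>?A. of_rat (q t) * f t) = 0"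
    using rat_dependent_family[OF _ card_reduced(1) f_span] finI by (auto simp: finite_PiE)
  have "(\<Sum>t\<in>?A. of_rat (q t) * f t)
      = (\<Prod>i\<in>I. c i (e i) ^ T) * (\<Sum>t\<in>?A. of_rat (q t) * (\<Prod>i\<in>I. x i ^ t i))"
    by (simp add: f_def prod.distrib sum_distrib_left mult_ac)
  moreover have "(\<Prod>i\<in>I. c i (e i) ^ T) \<noteq> 0"
    using finI lead by simp
  ultimately have "(\<Sum>t\<in>?A. of_rat (q t) * (\<Prod>i\<in>I. x i ^ t i)) = 0"
    using q(2) by simp
  then show False
    using algebraically_independent_monomials[OF ind finI] q(1) by blast
qed

section \<open>Points on nontrivial quadrics lose a degree of freedom\<close>

lemma algebraic_over_mono: "algebraic_over K r \<Longrightarrow> K \<subseteq> L \<Longrightarrow> algebraic_over L r"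
  unfolding algebraic_over_def by blast

lemma algebraic_over_quadratic:
  assumes K: "a \<in> K" "b \<in> K" "c \<in> K" and "a * r\<^sup>2 + b * r + c = 0" and "a \<noteq> 0 \<or> b \<noteq> 0"
  shows "algebraic_over K r"
proof (cases "a = 0")
  case True
  then show ?thesis
    using assms unfolding algebraic_over_def
    by (intro exI[of _ 1] exI[of _ "\<lambda>k. if k = 0 then c else b"]) (auto simp: algebra_simps)
next
  case False
  then show ?thesis
    using assms unfolding algebraic_over_def
    by (intro exI[of _ 2] exI[of _ "\<lambda>k. if k = 0 then c else if k = 1 then b else a"])
       (auto simp: algebra_simps power2_eq_square numeral_2_eq_2)
qed

lemma algebraic_over_member: "r \<in> rat_adjoin Y \<Longrightarrow> algebraic_over (rat_adjoin Y) r"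
  by (rule algebraic_over_quadratic[of 0 _ 1 "- r"]) (auto intro: rat_adjoin_intros)

text \<open>
  The nonzero coefficient of the quadric does not by itself give a nontrivial equation for a coordinate, since
  the coefficients of that equation involve the other coordinates and may vanish at the given
  point. If they vanish for every \<open>x k\<close>, then the quadric has no square terms and each partial
  derivative is zero at the point. Not all partial derivatives are identically zero, since a nonzero
  constant has no zeros; and one that is not is a linear equation that determines another coordinate.
\<close>

lemma quadric_coordinate_algebraic:
  fixes x :: "nat \<Rightarrow> real" and R :: "nat \<Rightarrow> nat \<Rightarrow> real"
  assumes R: "\<And>k l. k < d \<Longrightarrow> l < d \<Longrightarrow> R k l \<in> rat_adjoin Y"
    and r: "\<And>k. k < d \<Longrightarrow> r k \<in> rat_adjoin Y" and s: "s \<in> rat_adjoin Y"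
    and sym: "\<And>k l. k < d \<Longrightarrow> l < d \<Longrightarrow> R k l = R l k"
    and eq: "(\<Sum>k<d. \<Sum>l<d. R k l * x k * x l) + (\<Sum>k<d. r k * x k) + s = 0"
    and nontriv: "(\<exists>k<d. \<exists>l<d. R k l \<noteq> 0) \<or> (\<exists>k<d. r k \<noteq> 0) \<or> s \<noteq> 0"
  shows "\<exists>k<d. algebraic_over (rat_adjoin (Y \<union> x ` ({..<d} - {k}))) (x k)"
proof -
  let ?K = "\<lambda>k. rat_adjoin (Y \<union> x ` ({..<d} - {k}))"
  have Y_sub: "rat_adjoin Y \<subseteq> ?K k" for k
    by (rule rat_adjoin_mono) auto
  have R_in: "R i l \<in> ?K k" if "i < d" "l < d" for i l k
    using R[OF that] Y_sub by blast
  have r_in: "r l \<in> ?K k" if "l < d" for l k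
    using r[OF that] Y_sub by blast
  have s_in: "s \<in> ?K k" for k
    using s Y_sub by blast
  have x_in: "x l \<in> ?K k" if "l < d" "l \<noteq> k" for k l
    using that by (intro rat_adjoin_gen) auto
  define lin where "lin k = 2 * (\<Sum>l\<in>{..<d} - {k}. R k l * x l) + r k" for k
  define rest where "rest k = (\<Sum>i\<in>{..<d} - {k}. \<Sum>l\<in>{..<d} - {k}. R i l * x i * x l)
    + (\<Sum>l\<in>{..<d} - {k}. r l * x l) + s" for k
  have in_K: "R k k \<in> ?K k" "lin k \<in> ?K k" "rest k \<in> ?K k" if "k < d" for k
    using that unfolding lin_def rest_def
    by (auto intro!: rat_adjoin_add rat_adjoin_mult rat_adjoin_sum rat_adjoin_numeral x_in
        R_in r_in s_in)
  have expand: "R k k * (x k)\<^sup>2 + lin k * x k + rest k = 0" if k: "k < d" for k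
  proof -
    let ?D = "{..<d} - {k}"
    have split: "(\<Sum>i<d. f i) = f k + (\<Sum>i\<in>?D. f i)" for f :: "nat \<Rightarrow> real"
      using k by (simp add: sum.remove)
    have "(\<Sum>i<d. \<Sum>l<d. R i l * x i * x l)
        = R k k * x k * x k + (\<Sum>l\<in>?D. R k l * x k * x l)
          + ((\<Sum>i\<in>?D. R i k * x i * x k) + (\<Sum>i\<in>?D. \<Sum>l\<in>?D. R i l * x i * x l))"
      by (simp add: split sum.distrib)
    also have "(\<Sum>i\<in>?D. R i k * x i * x k) = (\<Sum>l\<in>?D. R k l * x k * x l)"
      using k sym by (intro sum.cong) auto
    also have "(\<Sum>l\<in>?D. R k l * x k * x l) = x k * (\<Sum>l\<in>?D. R k l * x l)"
      by (simp add: sum_distrib_left mult_ac)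
    finally show ?thesis
      using eq unfolding lin_def rest_def split[of "\<lambda>k. r k * x k"]
      by (simp add: algebra_simps power2_eq_square)
  qed
  show ?thesis
  proof (cases "\<exists>k<d. R k k \<noteq> 0 \<or> lin k \<noteq> 0")
    case True
    then obtain k where "k < d" "R k k \<noteq> 0 \<or> lin k \<noteq> 0" by blast
    then show ?thesis
      using algebraic_over_quadratic[OF in_K expand] by blast
  next
    case False
    then have diag0: "R k k = 0" and lin0: "lin k = 0" if "k < d" for k
      using that by auto
    show ?thesis
    proof (cases "\<exists>k<d. \<exists>l<d. R k l \<noteq> 0")
      case True
      then obtain k l where kl: "k < d" "l < d" "R k l \<noteq> 0" by blast
      with diag0 have "l \<noteq> k" by auto
      define c where "c = 2 * (\<Sum>j\<in>{..<d} - {k} - {l}. R k j * x j) + r k"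
      have "0 * (x l)\<^sup>2 + (2 * R k l) * x l + c = lin k"
        using kl \<open>l \<noteq> k\<close> unfolding lin_def c_def
        by (subst sum.remove[of "{..<d} - {k}" l]) (auto simp: algebra_simps)
      moreover have "c \<in> ?K l"
        using kl unfolding c_def
        by (auto intro!: rat_adjoin_add rat_adjoin_mult rat_adjoin_sum rat_adjoin_numeral x_in
            R_in r_in)
      ultimately have "algebraic_over (?K l) (x l)"
        using kl lin0[OF kl(1)]
        by (intro algebraic_over_quadratic[of 0 _ "2 * R k l" c]) (auto intro: rat_adjoin_intros R_in)
      then show ?thesis using kl by blast
    next
      case False
      then have "\<And>k. k < d \<Longrightarrow> r k = 0"
        using lin0 by (simp add: lin_def)
      moreover from this False have "s = 0"
        using eq by simp
      ultimately show ?thesis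
        using nontriv False by blast
    qed
  qed
qed

text \<open>
  The dimension count: \<open>d * card W\<close> independent coordinates are algebraic over the \<open>card Y\<close> parameters
  together with the \<open>(d - 1) * card W\<close> coordinates that were not selected.
\<close>

lemma card_le_params:
  fixes x :: "'v \<times> nat \<Rightarrow> real"
  assumes ind: "algebraically_independent x (W \<times> {..<d})" and W: "finite W" and Y: "finite Y"
    and dep: "\<And>v. v \<in> W \<Longrightarrow>
      \<exists>k<d. algebraic_over (rat_adjoin (Y \<union> (\<lambda>l. x (v, l)) ` ({..<d} - {k}))) (x (v, k))"
  shows "card W \<le> card Y"
proof (cases "W = {}")
  case False
  obtain kk where kk: "\<And>v. v \<in> W \<Longrightarrow> kk v < d \<and>
      algebraic_over (rat_adjoin (Y \<union> (\<lambda>l. x (v, l)) ` ({..<d} - {kk v}))) (x (v, kk v))"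
    using dep by metis
  have "d > 0" using False kk by force
  define E where "E = (SIGMA v:W. {..<d} - {kk v})"
  have finE: "finite E"
    using W by (simp add: E_def)
  have "card (W \<times> {..<d}) \<le> card (Y \<union> x ` E)"
  proof (rule card_le_of_algebraic[OF ind])
    fix i assume "i \<in> W \<times> {..<d}"
    then obtain v k where i: "i = (v, k)" "v \<in> W" "k < d" by auto
    show "algebraic_over (rat_adjoin (Y \<union> x ` E)) (x i)"
    proof (cases "k = kk v")
      case True
      have "Y \<union> (\<lambda>l. x (v, l)) ` ({..<d} - {kk v}) \<subseteq> Y \<union> x ` E"
        using i by (auto simp: E_def)
      then show ?thesis
        using algebraic_over_mono[OF conjunct2[OF kk[OF i(2)]] rat_adjoin_mono] True i(1) by simp
    next
      case False
      then show ?thesis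
        using i by (intro algebraic_over_member rat_adjoin_gen) (auto simp: E_def)
    qed
  qed (use W Y finE in auto)
  also have "\<dots> \<le> card Y + card E"
    by (rule order_trans[OF card_Un_le]) (simp add: card_image_le finE)
  also have "card E = (\<Sum>v\<in>W. card ({..<d} - {kk v}))"
    unfolding E_def using W by (intro card_SigmaI) auto
  also have "\<dots> = card W * (d - 1)"
    using kk by simp
  finally show ?thesis
    using \<open>d > 0\<close> by (cases d) (auto simp: card_cartesian_product)
qed simp

text \<open>
  A hyperplane has \<open>d\<close> parameters once its equation is scaled to have a coefficient \<open>1\<close>, so it
  cannot contain \<open>d + 1\<close> generic points.
\<close>

lemma generic_points_not_in_hyperplane:
  fixes x :: "'v \<times> nat \<Rightarrow> real"
  assumes ind: "algebraically_independent x (W \<times> {..<d})" and W: "finite W" "card W = d + 1"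
    and hyp: "\<And>v. v \<in> W \<Longrightarrow> (\<Sum>k<d. u k * x (v, k)) = h"
    and k: "k < d"
  shows "u k = 0"
proof (rule ccontr)
  assume u: "u k \<noteq> 0"
  define Y where "Y = insert (h / u k) ((\<lambda>l. u l / u k) ` ({..<d} - {k}))"
  have "card Y \<le> Suc (card ((\<lambda>l. u l / u k) ` ({..<d} - {k})))"
    unfolding Y_def by (intro card_insert_le_m1) auto
  also have "\<dots> \<le> Suc (card ({..<d} - {k}))"
    by (simp add: card_image_le)
  also have "\<dots> = d"
    using k by simp
  finally have "card Y \<le> d" .
  moreover have "card W \<le> card Y"
  proof (rule card_le_params[OF ind W(1)])
    show "finite Y" by (simp add: Y_def)
    fix v assume v: "v \<in> W"
    show "\<exists>k<d. algebraic_over (rat_adjoin (Y \<union> (\<lambda>l. x (v, l)) ` ({..<d} - {k}))) (x (v, k))"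
    proof (rule quadric_coordinate_algebraic[where R = "\<lambda>_ _. 0" and r = "\<lambda>l. u l / u k"
          and s = "- (h / u k)"])
      show "u l / u k \<in> rat_adjoin Y" if "l < d" for l
        using that u by (cases "l = k") (auto simp: Y_def intro: rat_adjoin_intros)
      have "(\<Sum>l<d. u l / u k * x (v, l)) = h / u k"
        using hyp[OF v] by (simp add: sum_divide_distrib[symmetric])
      then show "(\<Sum>i<d. \<Sum>l<d. 0 * x (v, i) * x (v, l)) + (\<Sum>l<d. u l / u k * x (v, l)) + - (h / u k) = 0"
        by simp
      show "(\<exists>k<d. \<exists>l<d. (0::real) \<noteq> 0) \<or> (\<exists>l<d. u l / u k \<noteq> 0) \<or> - (h / u k) \<noteq> 0"
        using k u by auto
    qed (auto simp: Y_def intro: rat_adjoin_intros)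
  qed
  ultimately show False
    using W(2) by simp
qed

lemma generic_simplex_det:
  fixes x :: "'v \<times> nat \<Rightarrow> real"
  assumes ind: "algebraically_independent x (\<alpha> ` {..d} \<times> {..<d})" and inj: "inj_on \<alpha> {..d}"
  shows "det (mat d d (\<lambda>(i, k). x (\<alpha> (Suc i), k) - x (\<alpha> 0, k))) \<noteq> 0"
proof
  let ?A = "mat d d (\<lambda>(i, k). x (\<alpha> (Suc i), k) - x (\<alpha> 0, k))"
  assume "det ?A = 0"
  then obtain u where u: "u \<in> carrier_vec d" "u \<noteq> 0\<^sub>v d" "?A *\<^sub>v u = 0\<^sub>v d"
    using det_0_iff_vec_prod_zero[of ?A d] by auto
  define h where "h = (\<Sum>k<d. u $ k * x (\<alpha> 0, k))"
  have "(\<Sum>k<d. u $ k * x (\<alpha> i, k)) = h" if "i \<le> d" for i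
  proof (cases i)
    case (Suc j)
    then have "(?A *\<^sub>v u) $ j = 0" using u(3) that by simp
    then have "(\<Sum>k<d. u $ k * (x (\<alpha> (Suc j), k) - x (\<alpha> 0, k))) = 0"
      using that Suc u(1) by (simp add: scalar_prod_def mult.commute atLeast0LessThan)
    then show ?thesis
      by (simp add: Suc h_def right_diff_distrib sum_subtractf)
  qed (simp add: h_def)
  then have hyp: "(\<Sum>k<d. u $ k * x (v, k)) = h" if "v \<in> \<alpha> ` {..d}" for v
    using that by auto
  have "u $ k = 0" if "k < d" for k
    using generic_points_not_in_hyperplane[OF ind _ _ hyp that] inj by (simp add: card_image)
  then have "u = 0\<^sub>v d"
    using u(1) by (intro eq_vecI) auto
  with u(2) show False by simp
qed

section \<open>Bipartite distances determine both parts up to affine maps\<close>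

lemma two_sided_inverse:
  fixes A :: "real mat"
  assumes A: "A \<in> carrier_mat n n" and "det A \<noteq> 0"
  obtains B where "B \<in> carrier_mat n n" "A * B = 1\<^sub>m n" "B * A = 1\<^sub>m n"
proof
  note adj = adj_mat[OF A]
  let ?B = "inverse (det A) \<cdot>\<^sub>m adj_mat A"
  show "?B \<in> carrier_mat n n"
    using adj(1) by simp
  have one: "inverse (det A) \<cdot>\<^sub>m (det A \<cdot>\<^sub>m 1\<^sub>m n) = 1\<^sub>m n"
    using assms(2) by (intro eq_matI) auto
  show "A * ?B = 1\<^sub>m n"
    using mult_smult_distrib[OF A adj(1)] adj(2) one by simp
  show "?B * A = 1\<^sub>m n"
    using mult_smult_assoc_mat[OF adj(1) A] adj(3) one by simp
qed

lemma scalar_prod_diff_diff: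
  fixes a b :: "real vec"
  assumes "a \<in> carrier_vec d" "b \<in> carrier_vec d"
  shows "(a - b) \<bullet> (a - b) = a \<bullet> a - 2 * (a \<bullet> b) + b \<bullet> b"
  using assms comm_scalar_prod[of b d a]
  by (simp add: minus_scalar_prod_distrib[of _ d] scalar_prod_minus_distrib[of _ d])

text \<open>
  Only distances between \<open>{a, a'}\<close> and \<open>{b, b'}\<close> occur on the right: the squared norms of the
  points, which edges of a bipartite graph do not see directly, cancel.
\<close>

lemma double_difference:
  fixes a b :: "real vec"
  assumes "a \<in> carrier_vec d" "a' \<in> carrier_vec d" "b \<in> carrier_vec d" "b' \<in> carrier_vec d"
  shows "2 * ((a - a') \<bullet> (b - b')) = (a - b') \<bullet> (a - b') - (a - b) \<bullet> (a - b)
    + (a' - b) \<bullet> (a' - b) - (a' - b') \<bullet> (a' - b')"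
proof -
  have "(a - a') \<bullet> (b - b') = a \<bullet> b - a \<bullet> b' - a' \<bullet> b + a' \<bullet> b'"
    using assms by (simp add: minus_scalar_prod_distrib[of _ d] scalar_prod_minus_distrib[of _ d])
  then show ?thesis
    using assms by (simp add: scalar_prod_diff_diff[of _ d])
qed

text \<open>
  Write \<open>A\<close>, \<open>E\<close> for the matrices of edge vectors of the two simplices and \<open>A'\<close>, \<open>E'\<close> for those of their
  images. The double differences give \<open>A E\<^sup>T = A' E'\<^sup>T\<close>, so the image simplices are nondegenerate as
  well. A point of one part is determined by its inner products with the edge vectors of the
  simplex in the other part, which is why \<open>B\<close> comes from \<open>\<beta>\<close> and \<open>C\<close> from \<open>\<alpha>\<close>. Then
  \<open>E' B = E\<close> and \<open>A' C = A\<close> turn the matrix identity into \<open>A' (C B\<^sup>T) E'\<^sup>T = A' E'\<^sup>T\<close>.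
\<close>

lemma bipartite_distances_affine:
  fixes P Q :: "'v \<Rightarrow> real vec"
  assumes P: "\<And>v. P v \<in> carrier_vec d" and Q: "\<And>v. Q v \<in> carrier_vec d"
    and dist: "\<And>i j. i \<in> U \<Longrightarrow> j \<in> V \<Longrightarrow>
      (P i - P j) \<bullet> (P i - P j) = (Q i - Q j) \<bullet> (Q i - Q j)"
    and \<alpha>: "\<alpha> ` {..d} \<subseteq> U" "det (mat d d (\<lambda>(i, k). P (\<alpha> (Suc i)) $ k - P (\<alpha> 0) $ k)) \<noteq> 0"
    and \<beta>: "\<beta> ` {..d} \<subseteq> V" "det (mat d d (\<lambda>(i, k). P (\<beta> (Suc i)) $ k - P (\<beta> 0) $ k)) \<noteq> 0"
  shows "\<exists>B C s t. B \<in> carrier_mat d d \<and> C \<in> carrier_mat d d \<and> s \<in> carrier_vec d \<and> t \<in> carrier_vec d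
    \<and> B\<^sup>T * C = 1\<^sub>m d \<and> (\<forall>i\<in>U. Q i = B *\<^sub>v P i + s) \<and> (\<forall>j\<in>V. Q j = C *\<^sub>v P j + t)"
proof -
  define M where "M F \<gamma> = mat d d (\<lambda>(i, k). F (\<gamma> (Suc i)) $ k - F (\<gamma> 0) $ k)"
    for F :: "'v \<Rightarrow> real vec" and \<gamma> :: "nat \<Rightarrow> 'v"
  have M: "M F \<gamma> \<in> carrier_mat d d" for F \<gamma>
    by (simp add: M_def)
  have [simp]: "dim_row (M F \<gamma>) = d" "dim_col (M F \<gamma>) = d" for F \<gamma>
    by (simp_all add: M_def)
  have row_M: "row (M F \<gamma>) i = F (\<gamma> (Suc i)) - F (\<gamma> 0)"
    if "i < d" "\<And>v. F v \<in> carrier_vec d" for F \<gamma> i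
    using that by (intro eq_vecI) (auto simp: M_def carrier_vecD[OF that(2)])
  have dd: "(P i - P i') \<bullet> (P j - P j') = (Q i - Q i') \<bullet> (Q j - Q j')"
    if "i \<in> U" "i' \<in> U" "j \<in> V" "j' \<in> V" for i i' j j'
    using double_difference[OF P P P P, of i i' j j'] double_difference[OF Q Q Q Q, of i i' j j']
      dist that by simp
  have \<alpha>U: "\<alpha> i \<in> U" if "i \<le> d" for i using \<alpha>(1) that by auto
  have \<beta>V: "\<beta> i \<in> V" if "i \<le> d" for i using \<beta>(1) that by auto
  have gram: "M P \<alpha> * (M P \<beta>)\<^sup>T = M Q \<alpha> * (M Q \<beta>)\<^sup>T"
    using M by (intro eq_matI) (auto simp: row_M P Q intro!: dd \<alpha>U \<beta>V)
  have "det (M P \<alpha>) * det (M P \<beta>) = det (M Q \<alpha>) * det (M Q \<beta>)"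
    using arg_cong[OF gram, of det] M
    by (simp add: det_mult[of _ d] det_transpose[of _ d])
  then have detQ: "det (M Q \<alpha>) \<noteq> 0" "det (M Q \<beta>) \<noteq> 0"
    using \<alpha>(2) \<beta>(2) by (auto simp: M_def)
  obtain A' where A': "A' \<in> carrier_mat d d" "M Q \<alpha> * A' = 1\<^sub>m d" "A' * M Q \<alpha> = 1\<^sub>m d"
    using two_sided_inverse[OF M detQ(1)] by blast
  obtain B' where B': "B' \<in> carrier_mat d d" "M Q \<beta> * B' = 1\<^sub>m d" "B' * M Q \<beta> = 1\<^sub>m d"
    using two_sided_inverse[OF M detQ(2)] by blast
  define B where "B = B' * M P \<beta>"
  define C where "C = A' * M P \<alpha>"
  have BC: "B \<in> carrier_mat d d" "C \<in> carrier_mat d d"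
    using A' B' M by (auto simp: B_def C_def)
  have MB: "M Q \<beta> * B = M P \<beta>"
    unfolding B_def
    by (simp add: assoc_mult_mat[OF M B'(1) M, symmetric] B'(2) left_mult_one_mat[OF M])
  have MC: "M Q \<alpha> * C = M P \<alpha>"
    unfolding C_def
    by (simp add: assoc_mult_mat[OF M A'(1) M, symmetric] A'(2) left_mult_one_mat[OF M])
  have "M Q \<alpha> * (C * B\<^sup>T) * (M Q \<beta>)\<^sup>T = M P \<alpha> * (M P \<beta>)\<^sup>T"
  proof -
    have "M Q \<alpha> * (C * B\<^sup>T) * (M Q \<beta>)\<^sup>T = (M Q \<alpha> * C) * (B\<^sup>T * (M Q \<beta>)\<^sup>T)"
      using BC M by (simp add: assoc_mult_mat[of _ d d _ d _ d])
    also have "B\<^sup>T * (M Q \<beta>)\<^sup>T = (M P \<beta>)\<^sup>T"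
      by (simp add: transpose_mult[OF M BC(1), symmetric] MB)
    finally show ?thesis using MC by simp
  qed
  then have eq: "M Q \<alpha> * (C * B\<^sup>T) * (M Q \<beta>)\<^sup>T = M Q \<alpha> * (M Q \<beta>)\<^sup>T"
    using gram by simp
  have inv_t: "(M Q \<beta>)\<^sup>T * B'\<^sup>T = 1\<^sub>m d"
    by (simp add: transpose_mult[OF B'(1) M, symmetric] B'(3))
  have cancel: "A' * (M Q \<alpha> * X * (M Q \<beta>)\<^sup>T) * B'\<^sup>T = X" if X: "X \<in> carrier_mat d d" for X
  proof -
    have "A' * (M Q \<alpha> * X * (M Q \<beta>)\<^sup>T) * B'\<^sup>T = (A' * M Q \<alpha>) * X * ((M Q \<beta>)\<^sup>T * B'\<^sup>T)"
      using X A'(1) B'(1) M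
      by (simp add: assoc_mult_mat[of _ d d _ d _ d] mult_carrier_mat[of _ d d _ d])
    then show ?thesis using A'(3) inv_t X by simp
  qed
  have "C * B\<^sup>T = 1\<^sub>m d"
    using cancel[of "C * B\<^sup>T"] cancel[of "1\<^sub>m d"] eq BC M by simp
  then have BTC: "B\<^sup>T * C = 1\<^sub>m d"
    using mat_mult_left_right_inverse[of C d "B\<^sup>T"] BC by simp
  have diffU: "Q i - Q (\<alpha> 0) = B *\<^sub>v (P i - P (\<alpha> 0))" if i: "i \<in> U" for i
  proof -
    have "M Q \<beta> *\<^sub>v (Q i - Q (\<alpha> 0)) = M P \<beta> *\<^sub>v (P i - P (\<alpha> 0))"
      using dd[OF i \<alpha>U \<beta>V \<beta>V, of 0 _ 0] comm_scalar_prod[of _ d] P Q M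
      by (intro eq_vecI) (auto simp: row_M P Q comm_scalar_prod[of _ d])
    then have "B' *\<^sub>v (M Q \<beta> *\<^sub>v (Q i - Q (\<alpha> 0))) = B' *\<^sub>v (M P \<beta> *\<^sub>v (P i - P (\<alpha> 0)))"
      by simp
    then show ?thesis
      using B' M P Q assoc_mult_mat_vec[of B' d d "M Q \<beta>" d "Q i - Q (\<alpha> 0)"]
        assoc_mult_mat_vec[of B' d d "M P \<beta>" d "P i - P (\<alpha> 0)"]
      by (simp add: B_def)
  qed
  have diffV: "Q j - Q (\<beta> 0) = C *\<^sub>v (P j - P (\<beta> 0))" if j: "j \<in> V" for j
  proof -
    have "M Q \<alpha> *\<^sub>v (Q j - Q (\<beta> 0)) = M P \<alpha> *\<^sub>v (P j - P (\<beta> 0))"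
      using dd[OF \<alpha>U \<alpha>U j \<beta>V, of _ 0 0] P Q M
      by (intro eq_vecI) (auto simp: row_M P Q)
    then have "A' *\<^sub>v (M Q \<alpha> *\<^sub>v (Q j - Q (\<beta> 0))) = A' *\<^sub>v (M P \<alpha> *\<^sub>v (P j - P (\<beta> 0)))"
      by simp
    then show ?thesis
      using A' M P Q assoc_mult_mat_vec[of A' d d "M Q \<alpha>" d "Q j - Q (\<beta> 0)"]
        assoc_mult_mat_vec[of A' d d "M P \<alpha>" d "P j - P (\<beta> 0)"]
      by (simp add: C_def)
  qed
  have affine: "x = N *\<^sub>v y + (x0 - N *\<^sub>v y0)" if "x - x0 = N *\<^sub>v (y - y0)"
    "N \<in> carrier_mat d d" "x \<in> carrier_vec d" "x0 \<in> carrier_vec d" "y \<in> carrier_vec d" "y0 \<in> carrier_vec d"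
    for x x0 y y0 :: "real vec" and N
  proof -
    have "x - x0 = N *\<^sub>v y - N *\<^sub>v y0"
      by (rule trans[OF that(1) mult_minus_distrib_mat_vec[OF that(2,5,6)]])
    then have "x $ i - x0 $ i = (N *\<^sub>v y) $ i - (N *\<^sub>v y0) $ i" if "i < d" for i
      using that \<open>N \<in> carrier_mat d d\<close> \<open>x0 \<in> carrier_vec d\<close>
      by (metis carrier_matD(1) carrier_vecD dim_mult_mat_vec index_minus_vec(1))
    then show ?thesis
      using that by (intro eq_vecI) (auto simp: algebra_simps simp del: index_mult_mat_vec)
  qed
  show ?thesis
  proof (intro exI conjI ballI)
    show "Q i = B *\<^sub>v P i + (Q (\<alpha> 0) - B *\<^sub>v P (\<alpha> 0))" if "i \<in> U" for i
      by (rule affine[OF diffU[OF that] BC(1) Q Q P P])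
    show "Q j = C *\<^sub>v P j + (Q (\<beta> 0) - C *\<^sub>v P (\<beta> 0))" if "j \<in> V" for j
      by (rule affine[OF diffV[OF that] BC(2) Q Q P P])
  qed (use BC BTC P Q in auto)
qed

section \<open>The quadric equations have only the trivial solution\<close>

lemma quadratic_form_sum:
  fixes M :: "real mat"
  assumes "M \<in> carrier_mat d d" "u \<in> carrier_vec d"
  shows "u \<bullet> (M *\<^sub>v u) = (\<Sum>k<d. \<Sum>l<d. M $$ (k, l) * u $ k * u $ l)"
  using assms
  by (auto simp: scalar_prod_def atLeast0LessThan sum_distrib_left mult_ac intro!: sum.cong)

lemma det_in_rat_adjoin:
  assumes A: "A \<in> carrier_mat n n" and el: "\<And>i j. i < n \<Longrightarrow> j < n \<Longrightarrow> A $$ (i, j) \<in> rat_adjoin Y"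
  shows "det A \<in> rat_adjoin Y"
  unfolding det_def'[OF A]
proof (intro rat_adjoin_sum rat_adjoin_mult rat_adjoin_prod)
  fix p i assume "p \<in> {p. p permutes {0..<n}}" "i \<in> {0..<n}"
  then show "A $$ (i, p i) \<in> rat_adjoin Y"
    using el permutes_in_image[of p "{0..<n}" i] by auto
qed (auto simp: sign_def intro: rat_adjoin_intros)

text \<open>
  The adjugate expresses the inverse of a matrix through polynomials in its entries, up to the
  determinant as a factor. Hence the inverse brings no new parameters into the count.
\<close>

lemma adj_mat_in_rat_adjoin:
  assumes A: "A \<in> carrier_mat n n" and el: "\<And>i j. i < n \<Longrightarrow> j < n \<Longrightarrow> A $$ (i, j) \<in> rat_adjoin Y"
    and ij: "i < n" "j < n"
  shows "adj_mat A $$ (i, j) \<in> rat_adjoin Y"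
proof -
  have "det (mat_delete A j i) \<in> rat_adjoin Y"
  proof (rule det_in_rat_adjoin)
    show "mat_delete A j i \<in> carrier_mat (n - 1) (n - 1)"
      using A by (auto simp: mat_delete_def)
    show "mat_delete A j i $$ (k, l) \<in> rat_adjoin Y" if "k < n - 1" "l < n - 1" for k l
      using that A by (auto simp: mat_delete_def intro!: el)
  qed
  moreover have "(- 1) ^ m \<in> rat_adjoin Y" for m
    by (induction m) (auto intro: rat_adjoin_intros)
  ultimately show ?thesis
    using A ij by (auto simp: adj_mat_def cofactor_def intro: rat_adjoin_mult)
qed

text \<open>
  The entries of \<open>S\<close> on and above the diagonal suffice, because \<open>S\<close> will be symmetric. The sum
  \<open>1 + d + d (d + 1) / 2\<close> is the dimension of the space of polynomials of degree at most two on \<open>d\<close>-space.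
\<close>

lemma card_quadric_params:
  fixes S :: "real mat" and y :: "real vec" and \<kappa> :: real and d :: nat
  defines "Y \<equiv> insert \<kappa> ((\<lambda>k. y $ k) ` {..<d} \<union> (\<lambda>(l, k). S $$ (k, l)) ` (SIGMA l:{..<d}. {..l}))"
  shows "finite Y" "card Y \<le> (d + 2) choose 2"
proof -
  show "finite Y"
    by (simp add: Y_def)
  have "card Y \<le> Suc (card ((\<lambda>k. y $ k) ` {..<d} \<union> (\<lambda>(l, k). S $$ (k, l)) ` (SIGMA l:{..<d}. {..l})))"
    unfolding Y_def by (intro card_insert_le_m1) auto
  also have "\<dots> \<le> Suc (card {..<d} + card (SIGMA l:{..<d}. {..l}))"
    by (intro Suc_leI le_imp_less_Suc order_trans[OF card_Un_le] add_mono card_image_le) auto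
  also have "\<dots> = Suc (d + (\<Sum>l<d. Suc l))"
    by (simp add: card_SigmaI)
  also have "\<dots> = (d + 2) choose 2"
    by (induction d) (simp_all add: numeral_2_eq_2)
  finally show "card Y \<le> (d + 2) choose 2" .
qed

lemma shifted_quadratic_expand:
  fixes a y :: "nat \<Rightarrow> real"
  assumes sym: "\<And>k l. k < d \<Longrightarrow> l < d \<Longrightarrow> S k l = S l k"
  shows "(\<Sum>k<d. \<Sum>l<d. S k l * (a k + y k) * (a l + y l)) - (\<Sum>k<d. a k * a k) - \<kappa>
    = (\<Sum>k<d. \<Sum>l<d. (S k l - of_bool (k = l)) * a k * a l)
      + (\<Sum>k<d. 2 * (\<Sum>l<d. S k l * y l) * a k)
      + ((\<Sum>k<d. \<Sum>l<d. S k l * y k * y l) - \<kappa>)"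
proof -
  have "(\<Sum>k<d. \<Sum>l<d. S k l * y k * a l) = (\<Sum>l<d. \<Sum>k<d. S k l * y k * a l)"
    by (rule sum.swap)
  also have "\<dots> = (\<Sum>k<d. \<Sum>l<d. S k l * y l * a k)"
    using sym by (intro sum.cong) auto
  finally have swap: "(\<Sum>k<d. \<Sum>l<d. S k l * y k * a l) = (\<Sum>k<d. \<Sum>l<d. S k l * y l * a k)" .
  have diag: "(\<Sum>k<d. \<Sum>l<d. of_bool (k = l) * a k * a l) = (\<Sum>k<d. a k * a k)"
    by (simp add: of_bool_def if_distrib if_distribR cong: if_cong)
  show ?thesis
    using swap diag
    by (simp add: algebra_simps sum.distrib sum_subtractf sum_distrib_left sum_distrib_right)
qed

text \<open>
  All points lie on quadrics with coefficients in the ring generated by the entries of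
  \<open>S\<close>, \<open>y\<close> and \<open>\<kappa>\<close>, the second kind of quadric after scaling by \<open>det S\<close>. There are more points than such
  entries, so the two quadrics cannot both be nontrivial by \<open>card_le_params\<close>. But each of the two is
  trivial only if \<open>S = 1\<close> and \<open>y = 0\<close>.
\<close>

lemma generic_quadric_system_trivial:
  fixes p :: "'v \<Rightarrow> nat \<Rightarrow> real" and S T :: "real mat"
  assumes ind: "algebraically_independent (\<lambda>(v, k). p v k) ((U \<union> V) \<times> {..<d})"
    and fin: "finite (U \<union> V)" and card: "card (U \<union> V) > (d + 2) choose 2"
    and S: "S \<in> carrier_mat d d" and T: "T \<in> carrier_mat d d" and y: "y \<in> carrier_vec d"
    and TS: "T * S = 1\<^sub>m d" and sym: "S\<^sup>T = S" "T\<^sup>T = T"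
    and U: "\<And>v. v \<in> U \<Longrightarrow>
      (vec d (p v) + y) \<bullet> (S *\<^sub>v (vec d (p v) + y)) - vec d (p v) \<bullet> vec d (p v) = \<kappa>"
    and V: "\<And>v. v \<in> V \<Longrightarrow>
      vec d (p v) \<bullet> vec d (p v) - vec d (p v) \<bullet> (T *\<^sub>v vec d (p v)) + 2 * (y \<bullet> vec d (p v)) = \<kappa>"
  shows "S = 1\<^sub>m d \<and> y = 0\<^sub>v d"
proof (rule ccontr)
  assume nontriv: "\<not> (S = 1\<^sub>m d \<and> y = 0\<^sub>v d)"
  define Y where
    "Y = insert \<kappa> ((\<lambda>k. y $ k) ` {..<d} \<union> (\<lambda>(l, k). S $$ (k, l)) ` (SIGMA l:{..<d}. {..l}))"
  have symS: "S $$ (k, l) = S $$ (l, k)" and symT: "T $$ (k, l) = T $$ (l, k)"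
    if "k < d" "l < d" for k l
    using arg_cong[OF sym(1), of "\<lambda>M. M $$ (k, l)"] arg_cong[OF sym(2), of "\<lambda>M. M $$ (k, l)"]
      S T that by auto
  have \<kappa>_in: "\<kappa> \<in> rat_adjoin Y"
    by (auto simp: Y_def intro: rat_adjoin_gen)
  have y_in: "y $ k \<in> rat_adjoin Y" if "k < d" for k
    using that by (auto simp: Y_def intro: rat_adjoin_gen)
  have S_in: "S $$ (k, l) \<in> rat_adjoin Y" if "k < d" "l < d" for k l
  proof -
    have "S $$ (k, l) \<in> Y" if "k \<le> l" "l < d" for k l
      unfolding Y_def using that by (intro insertI2 UnI2 image_eqI[of _ _ "(l, k)"]) auto
    then show ?thesis
      using that symS[OF that] by (metis nat_le_linear rat_adjoin_gen)
  qed
  have det_in: "det S \<in> rat_adjoin Y"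
    by (rule det_in_rat_adjoin[OF S S_in])
  have det0: "det S \<noteq> 0"
    using arg_cong[OF TS, of det] det_mult[OF T S] by auto
  have "adj_mat S = (T * S) * adj_mat S"
    using TS adj_mat(1)[OF S] by simp
  also have "\<dots> = T * (det S \<cdot>\<^sub>m 1\<^sub>m d)"
    using assoc_mult_mat[OF T S adj_mat(1)[OF S]] adj_mat(2)[OF S] by simp
  also have "\<dots> = det S \<cdot>\<^sub>m T"
    using mult_smult_distrib[OF T one_carrier_mat, of "det S"] T by simp
  finally have "adj_mat S $$ (k, l) = det S * T $$ (k, l)" if "k < d" "l < d" for k l
    using T that by simp
  then have T_in: "det S * T $$ (k, l) \<in> rat_adjoin Y" if "k < d" "l < d" for k l
    using adj_mat_in_rat_adjoin[OF S S_in that] that by simp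
  have delta: "M = 1\<^sub>m d" if "\<And>k l. k < d \<Longrightarrow> l < d \<Longrightarrow> M $$ (k, l) = of_bool (k = l)"
    "M \<in> carrier_mat d d" for M :: "real mat"
    using that by (intro eq_matI) auto
  have delta_in: "of_bool b \<in> rat_adjoin Y" for b
    by (cases b) (auto intro: rat_adjoin_intros)
  have nt: "S \<noteq> 1\<^sub>m d \<or> (\<exists>k<d. y $ k \<noteq> 0)"
    using nontriv y by (auto intro!: eq_vecI)
  have "card (U \<union> V) \<le> card Y"
  proof (rule card_le_params[OF ind fin])
    show "finite Y"
      unfolding Y_def by (rule card_quadric_params)
    fix v assume "v \<in> U \<union> V"
    then consider "v \<in> U" | "v \<in> V" by blast
    then have "\<exists>k<d. algebraic_over (rat_adjoin (Y \<union> p v ` ({..<d} - {k}))) (p v k)"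
    proof cases
      case 1
      let ?R = "\<lambda>k l. S $$ (k, l) - of_bool (k = l)"
      let ?r = "\<lambda>k. 2 * (\<Sum>l<d. S $$ (k, l) * y $ l)"
      let ?s = "(\<Sum>k<d. \<Sum>l<d. S $$ (k, l) * y $ k * y $ l) - \<kappa>"
      show ?thesis
      proof (rule quadric_coordinate_algebraic[where R = ?R and r = ?r and s = ?s])
        have "(vec d (p v) + y) \<bullet> (S *\<^sub>v (vec d (p v) + y))
            = (\<Sum>k<d. \<Sum>l<d. S $$ (k, l) * (p v k + y $ k) * (p v l + y $ l))"
          using S y by (subst quadratic_form_sum[of _ d]) (auto intro!: sum.cong)
        moreover have "vec d (p v) \<bullet> vec d (p v) = (\<Sum>k<d. p v k * p v k)"
          by (simp add: scalar_prod_def atLeast0LessThan)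
        ultimately show "(\<Sum>k<d. \<Sum>l<d. ?R k l * p v k * p v l) + (\<Sum>k<d. ?r k * p v k) + ?s = 0"
          using U[OF 1] shifted_quadratic_expand[of d "\<lambda>k l. S $$ (k, l)" "p v" "\<lambda>k. y $ k" \<kappa>] symS
          by simp
        show "(\<exists>k<d. \<exists>l<d. ?R k l \<noteq> 0) \<or> (\<exists>k<d. ?r k \<noteq> 0) \<or> ?s \<noteq> 0"
        proof (rule ccontr)
          assume "\<not> ?thesis"
          then have R0: "\<And>k l. k < d \<Longrightarrow> l < d \<Longrightarrow> ?R k l = 0" and r0: "\<And>k. k < d \<Longrightarrow> ?r k = 0"
            by blast+
          have "y $ k = 0" if "k < d" for k
          proof -
            have "(\<Sum>l<d. S $$ (k, l) * y $ l) = (\<Sum>l<d. if k = l then y $ l else 0)"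
              using R0[OF that] by (intro sum.cong) auto
            then show ?thesis using r0[OF that] that by simp
          qed
          moreover have "S = 1\<^sub>m d"
            using R0 S by (intro delta) auto
          ultimately show False
            using nt by blast
        qed
      qed (auto intro!: rat_adjoin_diff rat_adjoin_mult rat_adjoin_sum rat_adjoin_numeral
          rat_adjoin_0 rat_adjoin_1 S_in y_in \<kappa>_in delta_in simp: symS)
    next
      case 2
      let ?R = "\<lambda>k l. det S * (T $$ (k, l) - of_bool (k = l))"
      let ?r = "\<lambda>k. det S * (- 2 * y $ k)"
      let ?s = "det S * \<kappa>"
      show ?thesis
      proof (rule quadric_coordinate_algebraic[where R = ?R and r = ?r and s = ?s])
        have "vec d (p v) \<bullet> (T *\<^sub>v vec d (p v)) = (\<Sum>k<d. \<Sum>l<d. T $$ (k, l) * p v k * p v l)"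
          using T by (subst quadratic_form_sum[of _ d]) (auto intro!: sum.cong)
        moreover have "vec d (p v) \<bullet> vec d (p v) = (\<Sum>k<d. p v k * p v k)"
          "y \<bullet> vec d (p v) = (\<Sum>k<d. y $ k * p v k)"
          by (simp_all add: scalar_prod_def atLeast0LessThan)
        moreover have "(\<Sum>k<d. \<Sum>l<d. of_bool (k = l) * p v k * p v l) = (\<Sum>k<d. p v k * p v k)"
          by (simp add: of_bool_def if_distrib if_distribR cong: if_cong)
        ultimately have "(\<Sum>k<d. \<Sum>l<d. (T $$ (k, l) - of_bool (k = l)) * p v k * p v l)
            + (\<Sum>k<d. - 2 * y $ k * p v k) + \<kappa> = 0"
          using V[OF 2]
          by (simp add: algebra_simps sum.distrib sum_subtractf sum_negf sum_distrib_left)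
        then have "det S * ((\<Sum>k<d. \<Sum>l<d. (T $$ (k, l) - of_bool (k = l)) * p v k * p v l)
            + (\<Sum>k<d. - 2 * y $ k * p v k) + \<kappa>) = 0"
          by simp
        then show "(\<Sum>k<d. \<Sum>l<d. ?R k l * p v k * p v l) + (\<Sum>k<d. ?r k * p v k) + ?s = 0"
          by (simp only: distrib_left sum_distrib_left mult.assoc)
        show "(\<exists>k<d. \<exists>l<d. ?R k l \<noteq> 0) \<or> (\<exists>k<d. ?r k \<noteq> 0) \<or> ?s \<noteq> 0"
        proof (rule ccontr)
          assume "\<not> ?thesis"
          then have R0: "\<And>k l. k < d \<Longrightarrow> l < d \<Longrightarrow> ?R k l = 0" and r0: "\<And>k. k < d \<Longrightarrow> ?r k = 0"
            by blast+
          have "T = 1\<^sub>m d"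
            using R0 det0 T by (intro delta) auto
          then have "S = 1\<^sub>m d"
            using TS S by simp
          then show False
            using nt r0 det0 by auto
        qed
        show "?R k l \<in> rat_adjoin Y" if "k < d" "l < d" for k l
          using T_in[OF that] det_in delta_in
          by (auto simp: right_diff_distrib intro!: rat_adjoin_diff rat_adjoin_mult)
      qed (auto intro!: rat_adjoin_mult rat_adjoin_uminus rat_adjoin_numeral y_in \<kappa>_in det_in
          simp: symT)
    qed
    then show "\<exists>k<d. algebraic_over (rat_adjoin (Y \<union> (\<lambda>l. (case (v, l) of (v, k) \<Rightarrow> p v k)) ` ({..<d} - {k})))
        (case (v, k) of (v, k) \<Rightarrow> p v k)"
      by simp
  qed
  also have "\<dots> \<le> (d + 2) choose 2"
    unfolding Y_def by (rule card_quadric_params)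
  finally show False
    using card by simp
qed

section \<open>Global rigidity\<close>

lemma adjoint_scalar_prod:
  fixes A :: "real mat"
  assumes "A \<in> carrier_mat d d" "u \<in> carrier_vec d" "w \<in> carrier_vec d"
  shows "(A *\<^sub>v u) \<bullet> w = u \<bullet> (A\<^sup>T *\<^sub>v w)"
  using transpose_vec_mult_scalar[of A d d u w] assms
  by (metis comm_scalar_prod mult_mat_vec_carrier transpose_carrier_mat)

lemma vec_shift:
  fixes u v s t :: "real vec"
  assumes "u \<in> carrier_vec d" "v \<in> carrier_vec d" "s \<in> carrier_vec d" "t \<in> carrier_vec d"
  shows "(u + s) - (v + t) = (u + (s - t)) - v"
  using assms by (intro eq_vecI) auto

text \<open>
  Since \<open>(B a) \<bullet> (C b) = a \<bullet> b\<close>, the mixed terms of the distance equation cancel, up to a term in \<open>b\<close>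
  alone. The equation then equates an expression in \<open>a\<close> with one in \<open>b\<close>, so both are the same constant.
\<close>

lemma equivalent_generic_bipartite_orthogonal:
  fixes p :: "'v \<Rightarrow> nat \<Rightarrow> real" and Q :: "'v \<Rightarrow> real vec" and d :: nat
  defines "P \<equiv> \<lambda>v. vec d (p v)"
  assumes ind: "algebraically_independent (\<lambda>(v, k). p v k) ((U \<union> V) \<times> {..<d})"
    and fin: "finite (U \<union> V)" and card: "card (U \<union> V) > (d + 2) choose 2"
    and ne: "U \<noteq> {}" "V \<noteq> {}"
    and dist: "\<And>i j. i \<in> U \<Longrightarrow> j \<in> V \<Longrightarrow>
      (P i - P j) \<bullet> (P i - P j) = (Q i - Q j) \<bullet> (Q i - Q j)"
    and B: "B \<in> carrier_mat d d" and C: "C \<in> carrier_mat d d"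
    and s: "s \<in> carrier_vec d" and t: "t \<in> carrier_vec d" and BC: "B\<^sup>T * C = 1\<^sub>m d"
    and QU: "\<And>i. i \<in> U \<Longrightarrow> Q i = B *\<^sub>v P i + s" and QV: "\<And>j. j \<in> V \<Longrightarrow> Q j = C *\<^sub>v P j + t"
  shows "B\<^sup>T * B = 1\<^sub>m d \<and> (\<forall>v\<in>U \<union> V. Q v = B *\<^sub>v P v + t)"
proof -
  have P: "P v \<in> carrier_vec d" for v
    by (simp add: P_def)
  note mc = mult_carrier_mat[of _ d d _ d] and assoc = assoc_mult_mat[of _ d d _ d _ d]
  have BT: "B\<^sup>T \<in> carrier_mat d d" and CT: "C\<^sup>T \<in> carrier_mat d d"
    using B C by auto
  have CB: "C\<^sup>T * B = 1\<^sub>m d"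
    using arg_cong[OF BC, of transpose_mat] transpose_mult[OF BT C] by simp
  have BCT: "B * C\<^sup>T = 1\<^sub>m d"
    by (rule mat_mult_left_right_inverse[OF CT B CB])
  have CBT: "C * B\<^sup>T = 1\<^sub>m d"
    by (rule mat_mult_left_right_inverse[OF BT C BC])
  define w where "w = s - t"
  define y where "y = C\<^sup>T *\<^sub>v w"
  define S where "S = B\<^sup>T * B"
  define T where "T = C\<^sup>T * C"
  have w: "w \<in> carrier_vec d" and y: "y \<in> carrier_vec d"
    and S: "S \<in> carrier_mat d d" and T: "T \<in> carrier_mat d d"
    using s t B C by (auto simp: w_def y_def S_def T_def)
  have By: "B *\<^sub>v y = w"
    unfolding y_def using assoc_mult_mat_vec[OF B CT w] BCT w by simp
  have "T * S = C\<^sup>T * (C * B\<^sup>T) * B"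
    unfolding S_def T_def using B C BT CT by (simp add: assoc mc)
  then have TS: "T * S = 1\<^sub>m d"
    using CBT CB CT by simp
  have sym: "S\<^sup>T = S" "T\<^sup>T = T"
    using transpose_mult[OF BT B] transpose_mult[OF CT C] by (simp_all add: S_def T_def)
  \<comment> \<open>Separation of variables: every distance equation takes the form \<open>F i = H j\<close>.\<close>
  define F where
    "F v = (P v + y) \<bullet> (S *\<^sub>v (P v + y)) - P v \<bullet> P v" for v
  define H where
    "H v = P v \<bullet> P v - P v \<bullet> (T *\<^sub>v P v) + 2 * (y \<bullet> P v)" for v
  have FH: "F i = H j" if i: "i \<in> U" and j: "j \<in> V" for i j
  proof -
    let ?a = "P i" and ?b = "P j"
    have a: "?a \<in> carrier_vec d" and b: "?b \<in> carrier_vec d" by (rule P)+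
    have Ba: "B *\<^sub>v ?a \<in> carrier_vec d" and Cb: "C *\<^sub>v ?b \<in> carrier_vec d"
      using B C a b by auto
    have "Q i - Q j = (B *\<^sub>v ?a + w) - C *\<^sub>v ?b"
      unfolding QU[OF i] QV[OF j] w_def by (rule vec_shift[OF Ba Cb s t])
    then have "?a \<bullet> ?a - 2 * (?a \<bullet> ?b) + ?b \<bullet> ?b
        = (B *\<^sub>v ?a + w) \<bullet> (B *\<^sub>v ?a + w) - 2 * ((B *\<^sub>v ?a + w) \<bullet> (C *\<^sub>v ?b))
          + (C *\<^sub>v ?b) \<bullet> (C *\<^sub>v ?b)"
      using dist[OF i j] scalar_prod_diff_diff[OF a b]
        scalar_prod_diff_diff[of "B *\<^sub>v ?a + w" d "C *\<^sub>v ?b"] Ba Cb w by simp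
    moreover have "(B *\<^sub>v ?a + w) \<bullet> (C *\<^sub>v ?b) = ?a \<bullet> ?b + y \<bullet> ?b"
    proof -
      have "(B *\<^sub>v ?a) \<bullet> (C *\<^sub>v ?b) = ?a \<bullet> ((B\<^sup>T * C) *\<^sub>v ?b)"
        using adjoint_scalar_prod[OF B a Cb] assoc_mult_mat_vec[OF BT C b] by simp
      moreover have "w \<bullet> (C *\<^sub>v ?b) = y \<bullet> ?b"
        using adjoint_scalar_prod[OF CT w b] by (simp add: y_def)
      ultimately show ?thesis
        using add_scalar_prod_distrib[OF Ba w Cb] BC b by simp
    qed
    moreover have "(C *\<^sub>v ?b) \<bullet> (C *\<^sub>v ?b) = ?b \<bullet> (T *\<^sub>v ?b)"
      using adjoint_scalar_prod[OF C b Cb] assoc_mult_mat_vec[OF CT C b] by (simp add: T_def)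
    moreover have "(B *\<^sub>v ?a + w) \<bullet> (B *\<^sub>v ?a + w) = (?a + y) \<bullet> (S *\<^sub>v (?a + y))"
    proof -
      have ay: "?a + y \<in> carrier_vec d" using a y by simp
      have "B *\<^sub>v ?a + w = B *\<^sub>v (?a + y)"
        using mult_add_distrib_mat_vec[OF B a y] By by simp
      then show ?thesis
        using adjoint_scalar_prod[OF B ay, of "B *\<^sub>v (?a + y)"] assoc_mult_mat_vec[OF BT B ay] B ay
        by (simp add: S_def)
    qed
    ultimately show ?thesis
      by (simp add: F_def H_def)
  qed
  obtain i0 j0 where ij0: "i0 \<in> U" "j0 \<in> V" using ne by blast
  have FU: "F v = F i0" if "v \<in> U" for v
    using FH[OF that ij0(2)] FH[OF ij0] by simp
  have HV: "H v = F i0" if "v \<in> V" for v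
    using FH[OF ij0(1) that] by simp
  have Sy: "S = 1\<^sub>m d \<and> y = 0\<^sub>v d"
    by (rule generic_quadric_system_trivial[OF ind fin card S T y TS sym
          FU[unfolded F_def P_def] HV[unfolded H_def P_def F_def]])
  then have BB: "B\<^sup>T * B = 1\<^sub>m d"
    by (simp add: S_def)
  have "C = (C * B\<^sup>T) * B"
    using assoc[OF C BT B] BB C by simp
  then have "C = B"
    using CBT B by simp
  have "w = 0\<^sub>v d"
    using By Sy B by (auto simp flip: By)
  then have "s = t"
    using s t unfolding w_def
    by (metis eq_vecI carrier_vecD index_minus_vec(1) index_zero_vec(1) right_minus_eq)
  then show ?thesis
    using BB QU QV \<open>C = B\<close> by auto
qed

lemma edist_square: "(edist d x y)\<^sup>2 = (vec d x - vec d y) \<bullet> (vec d x - vec d y)"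
  by (simp add: edist_def L2_set_def sum_nonneg scalar_prod_def atLeast0LessThan power2_eq_square)

lemma edist_eq_iff:
  "edist d x y = edist d x' y' \<longleftrightarrow>
    (vec d x - vec d y) \<bullet> (vec d x - vec d y) = (vec d x' - vec d y') \<bullet> (vec d x' - vec d y')"
  by (simp add: edist_square[symmetric] edist_def L2_set_nonneg power2_eq_iff_nonneg)

lemma euclid_isometry_orthogonal:
  fixes B :: "real mat"
  assumes B: "B \<in> carrier_mat d d" "B\<^sup>T * B = 1\<^sub>m d" and t: "t \<in> carrier_vec d"
  shows "euclid_isometry d (\<lambda>x k. if k < d then (B *\<^sub>v vec d x + t) $ k else 0)"
  unfolding euclid_isometry_def
proof (intro conjI ballI)
  let ?T = "\<lambda>x k. if k < d then (B *\<^sub>v vec d x + t) $ k else 0"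
  show "?T \<in> euclid d \<rightarrow> euclid d"
    by (auto simp: topspace_Euclidean_space)
  fix x y :: "nat \<Rightarrow> real"
  have vecT: "vec d (?T x) = B *\<^sub>v vec d x + t" for x
    using B t by (intro eq_vecI) auto
  let ?u = "vec d x - vec d y"
  have "vec d (?T x) - vec d (?T y) = B *\<^sub>v vec d x - B *\<^sub>v vec d y"
    unfolding vecT using vec_shift[of "B *\<^sub>v vec d x" d "B *\<^sub>v vec d y" t t] B t by simp
  also have "\<dots> = B *\<^sub>v ?u"
    using mult_minus_distrib_mat_vec[OF B(1), of "vec d x" "vec d y"] by simp
  finally have diff: "vec d (?T x) - vec d (?T y) = B *\<^sub>v ?u" .
  have u: "?u \<in> carrier_vec d" by simp
  have "(B *\<^sub>v ?u) \<bullet> (B *\<^sub>v ?u) = ?u \<bullet> ((B\<^sup>T * B) *\<^sub>v ?u)"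
    using adjoint_scalar_prod[OF B(1) u, of "B *\<^sub>v ?u"]
      assoc_mult_mat_vec[OF _ B(1) u, of "B\<^sup>T" d] B(1) u by simp
  also have "\<dots> = ?u \<bullet> ?u"
    using B(2) by simp
  finally show "edist d (?T x) (?T y) = edist d x y"
    unfolding edist_eq_iff diff .
qed

lemma obtain_simplex:
  assumes "card U \<ge> d + 1"
  obtains \<alpha> :: "nat \<Rightarrow> 'v" where "inj_on \<alpha> {..d}" "\<alpha> ` {..d} \<subseteq> U"
proof -
  have "finite U"
    using assms by (intro card_ge_0_finite) simp
  then obtain f where f: "bij_betw f {0..<card U} U"
    using ex_bij_betw_nat_finite by blast
  have "{..d} \<subseteq> {0..<card U}"
    using assms by auto
  then show ?thesis
    using f that[of f] by (auto simp: bij_betw_def intro: inj_on_subset)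
qed

theorem theorem1p1:
  fixes d m n :: nat
    and G :: "('a, 'b) pre_digraph"
  assumes "m \<ge> d + 1" and "n \<ge> d + 1"
    and "m + n \<ge> ((d + 2) choose 2) + 1"
    and "complete_bipartite_digraph m n G"
  shows "generically_globally_rigid d G"
  unfolding generically_globally_rigid_def globally_rigid_def
proof (intro allI impI)
  fix p q :: "'a \<Rightarrow> nat \<Rightarrow> real"
  assume gen: "generic d G p" and q: "framework d G q" and eqv: "equivalent d G p q"
  obtain U V where UV: "verts G = U \<union> V" "U \<inter> V = {}" "card U = m" "card V = n"
    "arcs_ends G = U \<times> V \<union> V \<times> U"
    using assms(4) unfolding complete_bipartite_digraph_def by blast
  have finU: "finite U" and finV: "finite V"
    using UV assms(1,2) by (auto intro!: card_ge_0_finite)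
  define x where "x = (\<lambda>(v, k). p v k)"
  define P where "P v = vec d (p v)" for v
  define Q where "Q v = vec d (q v)" for v
  have ind: "algebraically_independent x ((U \<union> V) \<times> {..<d})"
    using gen UV(1) by (simp add: generic_def x_def)
  have dist: "(P i - P j) \<bullet> (P i - P j) = (Q i - Q j) \<bullet> (Q i - Q j)" if "i \<in> U" "j \<in> V" for i j
  proof -
    have "(j, i) \<in> arcs_ends G" using that UV(5) by auto
    then have "edist d (p i) (p j) = edist d (q i) (q j)"
      using eqv unfolding equivalent_def by blast
    then show ?thesis
      unfolding edist_eq_iff P_def Q_def .
  qed
  have simplex: "\<exists>\<alpha>. \<alpha> ` {..d} \<subseteq> X \<and> det (mat d d (\<lambda>(i, k). P (\<alpha> (Suc i)) $ k - P (\<alpha> 0) $ k)) \<noteq> 0"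
    if "card X \<ge> d + 1" "X \<subseteq> U \<union> V" for X
  proof -
    obtain \<alpha> where \<alpha>: "inj_on \<alpha> {..d}" "\<alpha> ` {..d} \<subseteq> X"
      using obtain_simplex[OF \<open>card X \<ge> d + 1\<close>] by blast
    have "algebraically_independent x (\<alpha> ` {..d} \<times> {..<d})"
      by (rule algebraically_independent_subset[OF ind]) (use \<alpha> that in auto)
    then have "det (mat d d (\<lambda>(i, k). x (\<alpha> (Suc i), k) - x (\<alpha> 0, k))) \<noteq> 0"
      by (rule generic_simplex_det[OF _ \<alpha>(1)])
    also have "mat d d (\<lambda>(i, k). x (\<alpha> (Suc i), k) - x (\<alpha> 0, k))
        = mat d d (\<lambda>(i, k). P (\<alpha> (Suc i)) $ k - P (\<alpha> 0) $ k)"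
      by (intro eq_matI) (auto simp: x_def P_def)
    finally show ?thesis using \<alpha>(2) by blast
  qed
  obtain \<alpha> where \<alpha>: "\<alpha> ` {..d} \<subseteq> U"
    "det (mat d d (\<lambda>(i, k). P (\<alpha> (Suc i)) $ k - P (\<alpha> 0) $ k)) \<noteq> 0"
    using simplex[of U] UV assms(1) by auto
  obtain \<beta> where \<beta>: "\<beta> ` {..d} \<subseteq> V"
    "det (mat d d (\<lambda>(i, k). P (\<beta> (Suc i)) $ k - P (\<beta> 0) $ k)) \<noteq> 0"
    using simplex[of V] UV assms(2) by auto
  obtain B C s t where BC: "B \<in> carrier_mat d d" "C \<in> carrier_mat d d" "s \<in> carrier_vec d"
    "t \<in> carrier_vec d" "B\<^sup>T * C = 1\<^sub>m d" and QU: "\<forall>i\<in>U. Q i = B *\<^sub>v P i + s"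
    and QV: "\<forall>j\<in>V. Q j = C *\<^sub>v P j + t"
    using bipartite_distances_affine[of P d Q U V, OF _ _ dist \<alpha> \<beta>]
    by (auto simp: P_def Q_def)
  have "card (U \<union> V) > (d + 2) choose 2"
    using card_Un_disjoint[OF finU finV UV(2)] UV assms(3) by simp
  moreover have "U \<noteq> {}" "V \<noteq> {}"
    using UV assms(1,2) by auto
  ultimately have ortho: "B\<^sup>T * B = 1\<^sub>m d \<and> (\<forall>v\<in>U \<union> V. Q v = B *\<^sub>v vec d (p v) + t)"
    using finU finV dist QU QV
    by (intro equivalent_generic_bipartite_orthogonal[OF ind[unfolded x_def] _ _ _ _ _ BC])
       (auto simp: P_def)
  let ?T = "\<lambda>x k. if k < d then (B *\<^sub>v vec d x + t) $ k else 0"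
  have "q v = ?T (p v)" if v: "v \<in> verts G" for v
  proof
    fix k
    show "q v k = ?T (p v) k"
    proof (cases "k < d")
      case True
      then have "q v k = Q v $ k" by (simp add: Q_def)
      then show ?thesis
        using ortho v UV(1) True by simp
    next
      case False
      then show ?thesis
        using q v by (auto simp: framework_def topspace_Euclidean_space Pi_iff)
    qed
  qed
  then show "congruent_frameworks d G p q"
    unfolding congruent_frameworks_def
    using euclid_isometry_orthogonal[OF BC(1) _ BC(4)] ortho by blast
qed

end
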